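(* Let $\ell\ge 1$ be an integer and let $\alpha_0\ge 1$ and $0<\beta\le (\ell+1)/(2\ell+1)$ be fixed reals. Suppose there is an infinite sequence $(G_i)_{i\ge 1}$, where $G_i$ is an $(m_i,n_i,a_i,b_i)$-graph of girth larger than $4\ell+2$ with $a_i\ge 2$, $n_i\to\infty$, such that for some constant $c_0>0$ every $G_i$ has at least $c_0(m_in_i)^{\beta}$ edges, and such that $\alpha_i:=\log_{a_i} b_i$ satisfies $1\le \alpha_i\le\alpha_0$ for all $i$. Then $$r(C_{2\ell+1},t)=\Omega\left(\frac{t^{\frac{\alpha\beta-3\beta+2}{\alpha-3\beta-\alpha\beta+2}}}{(\log t)^{\frac{3\alpha\beta-\alpha-3\beta+2}{\alpha-3\beta-\alpha\beta+2}}}\right)$$ for an infinite sequence of values of $t$, where $\alpha=\alpha_i$ for the corresponding $i$. That is, there exist a constant $c>0$, an infinite set $I$ of indices, and integers $t_i\ge 2$ for $i\in I$ with $t_i\to\infty$ as $i\to\infty$ in $I$, such that for every $i\in I$ the inequality $$r(C_{2\ell+1},t)\ \ge\ c\, t^{\frac{\alpha\beta-3\beta+2}{\alpha-3\beta-\alpha\beta+2}}\,(\log t)^{-\frac{3\alpha\beta-\alpha-3\beta+2}{\alpha-3\beta-\alpha\beta+2}}$$ holds with $t=t_i$ and $\alpha=\alpha_i$.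
   Context: All graphs are finite and simple; $C_k$ is the cycle of length $k$; $\log$ without a subscript is to base $2$. For a graph $F$ and an integer $t\ge 2$, $r(F,t)$ is the minimum $N$ such that every $N$-vertex $F$-free graph (no subgraph isomorphic to $F$, not necessarily induced) contains an independent set of order $t$. An $(m,n,a,b)$-graph is a bipartite graph with parts of orders $m$ and $n$, where $n\ge m$, such that all vertices in the part of size $n$ have degree $a$ and all vertices in the part of size $m$ have degree $b\ge a$. The girth of a graph is the length of its shortest cycle (infinite if there is none). *)

theory Defs
  imports Complex_Main "HOL-Library.Ramsey" "HOL-Library.Extended_Nat"
begin

record 'a graph =
  verts :: "'a set"
  edges :: "'a set set"

definition simple_graph :: "'a graph \<Rightarrow> bool" where
  "simple_graph G \<longleftrightarrow> finite (verts G) \<and> edges G \<subseteq> nsets (verts G) 2"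

definition subgraph :: "'a graph \<Rightarrow> 'a graph \<Rightarrow> bool" where
  "subgraph H G \<longleftrightarrow> simple_graph H \<and> verts H \<subseteq> verts G \<and> edges H \<subseteq> edges G"

definition isomorphic :: "'a graph \<Rightarrow> 'b graph \<Rightarrow> bool" where
  "isomorphic F H \<longleftrightarrow>
     (\<exists>f. bij_betw f (verts F) (verts H) \<and> edges H = (\<lambda>e. f ` e) ` edges F)"

definition has_copy :: "'a graph \<Rightarrow> 'b graph \<Rightarrow> bool" where
  "has_copy F G \<longleftrightarrow> (\<exists>H. subgraph H G \<and> isomorphic F H)"

text \<open>Only meaningful as the cycle of length \<open>k\<close> when \<open>k \<ge> 3\<close>.\<close>

definition cycle_graph :: "nat \<Rightarrow> nat graph" where
  "cycle_graph k = \<lparr>verts = {..<k}, edges = (\<lambda>i. {i, Suc i mod k}) ` {..<k}\<rparr>"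

text \<open>For an acyclic graph this is the infimum of the empty set, that is, \<open>\<infinity>\<close>.\<close>

definition girth :: "'a graph \<Rightarrow> enat" where
  "girth G = Inf (enat ` {k. k \<ge> 3 \<and> has_copy (cycle_graph k) G})"

definition degree :: "'a graph \<Rightarrow> 'a \<Rightarrow> nat" where
  "degree G v = card {e \<in> edges G. v \<in> e}"

definition has_indep_set :: "'a graph \<Rightarrow> nat \<Rightarrow> bool" where
  "has_indep_set G t \<longleftrightarrow> (\<exists>S \<subseteq> verts G. card S = t \<and> indep S (edges G))"

text \<open>An $(m,n,a,b)$-graph: the part \<open>A\<close> has \<open>m\<close> vertices of degree \<open>b\<close>,
  the part \<open>B\<close> has \<open>n\<close> vertices of degree \<open>a\<close>.\<close>

definition biregular :: "nat \<Rightarrow> nat \<Rightarrow> nat \<Rightarrow> nat \<Rightarrow> 'a graph \<Rightarrow> bool" where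
  "biregular m n a b G \<longleftrightarrow>
     simple_graph G \<and> m \<le> n \<and> a \<le> b \<and>
     (\<exists>A B. verts G = A \<union> B \<and> A \<inter> B = {} \<and> card A = m \<and> card B = n \<and>
        (\<forall>e \<in> edges G. \<exists>x \<in> A. \<exists>y \<in> B. e = {x, y}) \<and>
        (\<forall>v \<in> A. degree G v = b) \<and> (\<forall>v \<in> B. degree G v = a))"

text \<open>Every finite graph is isomorphic to one whose vertices are natural numbers, so it
  suffices to quantify over the latter.\<close>

definition ramsey_number :: "'a graph \<Rightarrow> nat \<Rightarrow> nat" where
  "ramsey_number F t = (LEAST N. \<forall>G :: nat graph.
     simple_graph G \<and> card (verts G) = N \<and> \<not> has_copy F G \<longrightarrow> has_indep_set G t)"

lemma simple_cycle_graph: "k \<ge> 3 \<Longrightarrow> simple_graph (cycle_graph k)"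
proof -
  assume k: "k \<ge> 3"
  have "{i, Suc i mod k} \<in> nsets {..<k} 2" if "i < k" for i
  proof (cases "Suc i = k")
    case True
    then show ?thesis using k that by simp
  next
    case False
    then have "Suc i mod k = Suc i" using that by simp
    then show ?thesis using k that False by simp
  qed
  then show ?thesis
    by (auto simp: simple_graph_def cycle_graph_def)
qed

lemma has_copyI:
  assumes F: "simple_graph F" and f: "inj_on f (verts F)" "f ` verts F \<subseteq> verts G"
    and e: "\<And>e. e \<in> edges F \<Longrightarrow> f ` e \<in> edges G"
  shows "has_copy F G"
proof -
  let ?H = "\<lparr>verts = f ` verts F, edges = (\<lambda>e. f ` e) ` edges F\<rparr>"
  have "f ` e \<in> nsets (f ` verts F) 2" if "e \<in> edges F" for e
  proof -
    have "e \<in> nsets (verts F) 2"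
      using F that by (auto simp: simple_graph_def)
    then show ?thesis
      using card_image[OF inj_on_subset[OF f(1), of e]] by (auto simp: nsets_def)
  qed
  then have "subgraph ?H G"
    using F f e by (auto simp: subgraph_def simple_graph_def)
  moreover have "isomorphic F ?H"
    using f(1) by (auto simp: isomorphic_def bij_betw_def)
  ultimately show ?thesis
    unfolding has_copy_def by blast
qed

text \<open>The minimum defining \<^const>\<open>ramsey_number\<close> is attained.\<close>

lemma ramsey_number_exists:
  fixes F :: "'a graph"
  assumes F: "simple_graph F"
  shows "\<exists>N. \<forall>G :: nat graph.
     simple_graph G \<and> card (verts G) = N \<and> \<not> has_copy F G \<longrightarrow> has_indep_set G t"
proof -
  obtain r where r: "\<And>(V :: nat set) E. finite V \<Longrightarrow> r \<le> card V \<Longrightarrow>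
      \<exists>R \<subseteq> V. card R = card (verts F) \<and> clique R E \<or> card R = t \<and> indep R E"
    using ramsey2[of "card (verts F)" t, where ?'a = nat] by metis
  have "has_indep_set G t"
    if G: "simple_graph G" "card (verts G) = r" "\<not> has_copy F G" for G :: "nat graph"
  proof -
    have fin: "finite (verts G)" "finite (verts F)"
      using G F by (auto simp: simple_graph_def)
    have False if R: "R \<subseteq> verts G" "card R = card (verts F)" "clique R (edges G)" for R
    proof -
      obtain f where f: "bij_betw f (verts F) R"
        using finite_same_card_bij[OF fin(2) finite_subset[OF R(1) fin(1)]] R(2) by auto
      have "f ` e \<in> edges G" if "e \<in> edges F" for e
      proof -
        have "e \<in> nsets (verts F) 2"
          using F that by (auto simp: simple_graph_def)
        then obtain x y where xy: "e = {x, y}" "x \<in> verts F" "y \<in> verts F" "x \<noteq> y"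
          by (elim nsets2_E) auto
        have "f x \<noteq> f y" "f x \<in> R" "f y \<in> R"
          using f xy by (auto simp: bij_betw_def inj_on_def)
        then show ?thesis
          using R(3) xy(1) by (simp add: clique_def)
      qed
      then have "has_copy F G"
        using f R(1) by (intro has_copyI[OF F]) (auto simp: bij_betw_def)
      then show False using G by simp
    qed
    moreover obtain R where "R \<subseteq> verts G"
      "card R = card (verts F) \<and> clique R (edges G) \<or> card R = t \<and> indep R (edges G)"
      using r[OF fin(1), of "edges G"] G(2) by auto
    ultimately show ?thesis
      unfolding has_indep_set_def by blast
  qed
  then show ?thesis by blast
qed

end

theory Submission
  imports Defs
begin

text \<open>Regard an \<open>(m, n, a, b)\<close>-graph as the incidence graph of \<open>m\<close> lines with \<open>b\<close> points each and \<open>n\<close> points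
on \<open>a\<close> lines each. Colour the points of each line at random with two colours,
and join two points whenever they have different colours on a common line. Since the girth exceeds
\<open>4 l + 2\<close>, a closed walk through at most \<open>2 l + 1\<close> distinct points stays on one line
(\<open>berge_closed_same_line\<close>). A cycle of length \<open>2 l + 1\<close> in the new graph would thus lie in the complete
bipartite graph on a single line, which is impossible (\<open>colour_graph_odd_cycle_free\<close>).

It remains to sample points so that no independent set of order \<open>t\<close> survives. Independent sets are
counted in expectation over the colourings (\<open>sum_independent_weight_le\<close>): once a set \<open>F\<close> has been
placed, each remaining point \<open>y\<close> is compatible with \<open>F\<close> with probability \<open>2^(-j)\<close>, where \<open>j\<close> is the
number of lines through \<open>y\<close> that meet \<open>F\<close>. The sum of these weights is \<open>n\<close> at the start, and while it
exceeds \<open>D = 32 m / a\<close> some point decreases it by a factor \<open>1 - a\<^sup>2 / (64 m)\<close>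
(\<open>exists_shrinking_point\<close>). About \<open>(m / a\<^sup>2) log n\<close> such points therefore confine the rest of the
independent set to weight \<open>D\<close>, and for \<open>t\<close> about \<open>(m / a\<^sup>2) (log n)\<^sup>2\<close> the expected number of
independent sets of order \<open>t\<close> is at most \<open>(2 D)^t / t!\<close>. A random sample of about \<open>t n / D\<close> points, that
is, of a constant times \<open>t b\<close> points, contains none of them (\<open>exists_colouring_and_sample\<close>).

This proves \<open>r(C, t) \<ge> t b / 576\<close> for the cycle \<open>C\<close> of length \<open>2 l + 1\<close> whenever \<open>a\<close> is large compared
with \<open>(log n)\<^sup>2\<close>. If \<open>\<beta> > 1/2\<close>, the edge bound forces \<open>a\<close> to be at least a constant times a power of \<open>n\<close>
(\<open>degree_ge_power\<close>) and \<open>b\<close> to be at least a constant times \<open>(m / a\<^sup>2)^x\<close> with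
\<open>x = \<alpha> (2 \<beta> - 1) / (\<alpha> - 3 \<beta> - \<alpha> \<beta> + 2)\<close> (\<open>degree_ratio_bound\<close>); as the two exponents
of the theorem are \<open>1 + x\<close> and \<open>2 x + 1\<close>, the bound follows. If \<open>\<beta> \<le> 1/2\<close>, then \<open>x \<le> 0\<close> and the
trivial bound \<open>r(C, t) \<ge> t\<close> is enough.\<close>

section \<open>Elementary symmetric sums\<close>

lemma sum_nsets_Suc_insert:
  fixes g :: "'a set \<Rightarrow> real"
  assumes "finite U" "x \<notin> U"
  shows "(\<Sum>R\<in>nsets (insert x U) (Suc r). g R) =
    (\<Sum>R\<in>nsets U (Suc r). g R) + (\<Sum>R\<in>nsets U r. g (insert x R))"
proof -
  have eq: "nsets (insert x U) (Suc r) = nsets U (Suc r) \<union> insert x ` nsets U r" (is "?l = ?r")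
  proof (rule antisym)
    show "?l \<subseteq> ?r"
    proof
      fix R assume R: "R \<in> ?l"
      show "R \<in> ?r"
      proof (cases "x \<in> R")
        case True
        have "R - {x} \<in> nsets U r" using R True by (auto simp: nsets_def)
        moreover have "R = insert x (R - {x})" using True by auto
        ultimately show ?thesis by blast
      next
        case False
        then show ?thesis using R by (auto simp: nsets_def)
      qed
    qed
    show "?r \<subseteq> ?l" using assms by (auto simp: nsets_def card_insert_if)
  qed
  have disj: "nsets U (Suc r) \<inter> insert x ` nsets U r = {}"
    using assms by (auto simp: nsets_def)
  have inj: "inj_on (insert x) (nsets U r)"
  proof (rule inj_onI)
    fix R R' assume "R \<in> nsets U r" "R' \<in> nsets U r" "insert x R = insert x R'"
    moreover from this have "x \<notin> R" "x \<notin> R'" using assms by (auto simp: nsets_def)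
    ultimately show "R = R'" by (simp add: insert_ident)
  qed
  show ?thesis
    unfolding eq using assms disj inj
    by (simp add: sum.union_disjoint finite_imp_finite_nsets sum.reindex)
qed

lemma elementary_symmetric_le:
  fixes f :: "'a \<Rightarrow> real"
  assumes "finite U" "\<And>x. x \<in> U \<Longrightarrow> f x \<ge> 0"
  shows "(\<Sum>R\<in>nsets U r. prod f R) \<le> sum f U ^ r / fact r"
  using assms
proof (induction U arbitrary: r rule: finite_induct)
  case empty
  then show ?case by (cases r) (auto simp: nsets_empty_iff)
next
  case (insert x U)
  show ?case
  proof (cases r)
    case 0
    then show ?thesis by simp
  next
    case (Suc q)
    let ?s = "sum f U" and ?y = "f x"
    have s: "?s \<ge> 0" and y: "?y \<ge> 0" using insert.prems by (auto intro: sum_nonneg)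
    have bern: "?s ^ Suc q + real (Suc q) * ?y * ?s ^ q \<le> (?s + ?y) ^ Suc q"
    proof (induction q)
      case 0 then show ?case by simp
    next
      case (Suc q)
      have "?s ^ Suc (Suc q) + real (Suc (Suc q)) * ?y * ?s ^ Suc q
          \<le> (?s + ?y) * (?s ^ Suc q + real (Suc q) * ?y * ?s ^ q)"
        using s y by (simp add: algebra_simps)
      also have "\<dots> \<le> (?s + ?y) * (?s + ?y) ^ Suc q"
        using Suc s y by (intro mult_left_mono) auto
      finally show ?case by simp
    qed
    have "(\<Sum>R\<in>nsets U q. prod f (insert x R)) = ?y * (\<Sum>R\<in>nsets U q. prod f R)"
      unfolding sum_distrib_left using insert.hyps
      by (intro sum.cong refl prod.insert) (auto simp: nsets_def)
    then have "(\<Sum>R\<in>nsets (insert x U) r. prod f R) =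
        (\<Sum>R\<in>nsets U (Suc q). prod f R) + ?y * (\<Sum>R\<in>nsets U q. prod f R)"
      using sum_nsets_Suc_insert[OF insert.hyps, of "prod f" q] Suc by simp
    also have "\<dots> \<le> ?s ^ Suc q / fact (Suc q) + ?y * (?s ^ q / fact q)"
      using insert.prems y by (intro add_mono mult_left_mono insert.IH) auto
    also have "\<dots> = (?s ^ Suc q + real (Suc q) * ?y * ?s ^ q) / fact (Suc q)"
      by (simp add: add_divide_distrib fact_Suc mult.assoc del: of_nat_Suc power_Suc)
    also have "\<dots> \<le> (?s + ?y) ^ Suc q / fact (Suc q)"
      using bern by (intro divide_right_mono) auto
    also have "?s + ?y = sum f (insert x U)" using insert.hyps by simp
    finally show ?thesis using Suc by simp
  qed
qed

section \<open>Linear systems and the survival weight\<close>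

text \<open>The incidence structure of a bipartite graph is a relation \<open>I\<close> between lines \<open>v\<close> and points \<open>y\<close>,
with the line first in the pair.\<close>

definition lines_through :: "('v \<times> 'p) set \<Rightarrow> 'p \<Rightarrow> 'v set" where
  "lines_through I y = {v. (v, y) \<in> I}"

text \<open>If every line is coloured with two colours independently and uniformly at random, one colour for
each incidence, this is for \<open>y \<notin> F\<close> the probability that \<open>y\<close> agrees, on each line that it shares with
\<open>F\<close>, with one fixed representative of \<open>F\<close> on that line.\<close>

definition survival :: "('v \<times> 'p) set \<Rightarrow> 'p set \<Rightarrow> 'p \<Rightarrow> real" where
  "survival I F y = (1 / 2) ^ card (lines_through I y \<inter> (\<Union>z\<in>F. lines_through I z))"

text \<open>Finitely many lines \<open>L\<close> and points \<open>B\<close>, with \<open>a\<close> lines through every point and at most one line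
through two distinct points.\<close>

locale linear_system =
  fixes L :: "'v set" and B :: "'p set" and I :: "('v \<times> 'p) set" and a :: nat
  assumes finL: "finite L" and finB: "finite B" and I_sub: "I \<subseteq> L \<times> B"
    and card_lines: "\<And>y. y \<in> B \<Longrightarrow> card (lines_through I y) = a"
    and linear: "\<And>x y. x \<in> B \<Longrightarrow> y \<in> B \<Longrightarrow> x \<noteq> y \<Longrightarrow>
      card (lines_through I x \<inter> lines_through I y) \<le> 1"
begin

lemma lines_sub: "lines_through I y \<subseteq> L"
  using I_sub by (auto simp: lines_through_def)

lemma finite_lines [simp]: "finite (lines_through I y)"
  using lines_sub finL finite_subset by blast

lemma survival_pos: "survival I F y > 0" and survival_le_1: "survival I F y \<le> 1"
  by (auto simp: survival_def power_le_one)

text \<open>As long as the total survival weight of \<open>U\<close> is at least \<open>32 |L| / a\<close>, some point of \<open>U\<close> reduces it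
at least by the factor \<open>1 - a\<^sup>2 / (64 |L|)\<close> when it is moved from \<open>U\<close> to \<open>F\<close>. The weights of a point \<open>y\<close> are
averaged over the lines not yet met by \<open>F\<close>: points with fewer than \<open>a / 2\<close> such lines have weight at
most \<open>1 / |B|\<close> because \<open>|B|\<^sup>2 \<le> 2^a\<close>, and are negligible. So the Cauchy-Schwarz inequality shows
that on its unmet lines a weighted random point sees at least \<open>a\<^sup>2 / (32 |L|)\<close> times the total weight. Half of that weight is lost
when the point joins \<open>F\<close>.\<close>

lemma exists_shrinking_point:
  assumes a: "a > 0" and U: "U \<subseteq> B" and ne: "U \<noteq> {}" and big: "32 * real (card L) / real a \<le> sum (survival I F) U"
    and na: "real (card B) ^ 2 \<le> 2 ^ a"
  shows "\<exists>x\<in>U. sum (survival I (insert x F)) (U - {x}) \<le>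
    (1 - real a ^ 2 / (64 * real (card L))) * sum (survival I F) U"
proof -
  define T where "T = (\<Union>z\<in>F. lines_through I z)"
  define w where "w = survival I F"
  define \<Phi> where "\<Phi> = sum w U"
  let ?m = "real (card L)" and ?n = "real (card B)"
  let ?ln = "lines_through I"
  define p where "p v = (\<Sum>y\<in>{y\<in>U. (v, y) \<in> I}. w y)" for v
  have finU: "finite U" using U finB finite_subset by blast
  have w: "0 < w y" "w y \<le> 1" for y using survival_pos survival_le_1 by (auto simp: w_def)
  obtain y0 where y0: "y0 \<in> B" using U ne by auto
  have npos: "?n > 0" using y0 finB by (auto simp: card_gt_0_iff)
  have "card (?ln y0) \<le> card L" by (intro card_mono finL lines_sub)
  then have am: "real a \<le> ?m" using card_lines[OF y0] by simp
  have mpos: "?m > 0" using am a by simp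
  have "32 * 1 \<le> 32 * (?m / real a)" using am a by (intro mult_left_mono) auto
  then have \<Phi>2: "\<Phi> \<ge> 2" using big by (simp add: \<Phi>_def w_def)
  define S where "S = (\<Sum>v\<in>L - T. p v)"
  have swap: "(\<Sum>v\<in>L - T. \<Sum>y\<in>{y\<in>U. (v, y) \<in> I}. h v y) = (\<Sum>y\<in>U. \<Sum>v\<in>?ln y - T. h v y)" for h :: "'v \<Rightarrow> 'p \<Rightarrow> real"
  proof -
    have "(\<Sum>v\<in>L - T. \<Sum>y\<in>{y\<in>U. (v, y) \<in> I}. h v y) = (\<Sum>y\<in>U. \<Sum>v\<in>{v\<in>L - T. (v, y) \<in> I}. h v y)"
      using finL finU by (intro sum.swap_restrict) auto
    also have "\<dots> = (\<Sum>y\<in>U. \<Sum>v\<in>?ln y - T. h v y)"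
      using I_sub by (intro sum.cong) (auto simp: lines_through_def)
    finally show ?thesis .
  qed
  have S_eq: "S = (\<Sum>y\<in>U. w y * real (card (?ln y - T)))"
    unfolding S_def p_def swap by (simp add: mult.commute)
  have S_up: "S \<le> real a * \<Phi>"
    unfolding S_eq \<Phi>_def sum_distrib_left
  proof (intro sum_mono)
    fix y assume "y \<in> U"
    then have "card (?ln y - T) \<le> a" using card_lines U card_mono[of "?ln y" "?ln y - T"] by auto
    then show "w y * real (card (?ln y - T)) \<le> real a * w y" using w[of y] by (simp add: mult.commute)
  qed
  have pw: "w y * real (card (?ln y - T)) \<ge> real a / 2 * (w y - 1 / ?n)" if "y \<in> U" for y
  proof (cases "2 * card (?ln y \<inter> T) \<le> a")
    case True
    have "card (?ln y - T) = a - card (?ln y \<inter> T)"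
      using card_lines[of y] that U by (metis card_Diff_subset_Int finite_Int finite_lines subsetD)
    then have "real (card (?ln y - T)) \<ge> real a / 2" using True by linarith
    then have "w y * real (card (?ln y - T)) \<ge> w y * (real a / 2)"
      using w[of y] by (intro mult_left_mono) auto
    moreover have "real a / 2 * (w y - 1 / ?n) \<le> w y * (real a / 2)"
      by (simp add: algebra_simps)
    ultimately show ?thesis by linarith
  next
    case False
    have "w y ^ 2 = (1/2) ^ (2 * card (?ln y \<inter> T))"
      by (simp add: w_def survival_def T_def power_mult[symmetric] mult.commute)
    also have "\<dots> \<le> (1/2) ^ a" using False by (intro power_decreasing) auto
    also have "\<dots> = 1 / 2 ^ a" by (simp add: power_divide)
    also have "\<dots> \<le> 1 / ?n ^ 2" using na npos by (intro divide_left_mono) auto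
    finally have "w y ^ 2 \<le> (1 / ?n) ^ 2" by (simp add: power_divide)
    then have "w y \<le> 1 / ?n" by (rule power2_le_imp_le) simp
    then have "real a / 2 * (w y - 1 / ?n) \<le> 0" by (intro mult_nonneg_nonpos) auto
    then show ?thesis using mult_nonneg_nonneg[of "w y" "real (card (?ln y - T))"] w[of y] by linarith
  qed
  \<comment> \<open>the exceptional points cost at most \<open>|U| / |B| \<le> 1 \<le> \<Phi> / 2\<close>\<close>
  have S_low: "S \<ge> real a * \<Phi> / 4"
  proof -
    have "card U \<le> card B" by (intro card_mono finB U)
    then have "real (card U) / ?n \<le> 1" using npos by simp
    then have "\<Phi> / 2 \<le> \<Phi> - real (card U) / ?n" using \<Phi>2 by linarith
    then have "real a / 2 * (\<Phi> / 2) \<le> real a / 2 * (\<Phi> - real (card U) / ?n)"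
      by (intro mult_left_mono) auto
    also have "\<dots> = (\<Sum>y\<in>U. real a / 2 * (w y - 1 / ?n))"
      unfolding sum_distrib_left[symmetric] sum_subtractf \<Phi>_def by simp
    also have "\<dots> \<le> S" unfolding S_eq using pw by (intro sum_mono) auto
    finally show ?thesis by simp
  qed
  define g where "g x = (\<Sum>v\<in>?ln x - T. p v - w x)" for x
  have CS: "S ^ 2 / ?m \<le> (\<Sum>v\<in>L - T. p v ^ 2)"
  proof -
    let ?c = "S / ?m"
    have "card (L - T) \<le> card L" using finL by (intro card_mono) auto
    then have "real (card (L - T)) * ?c ^ 2 \<le> ?m * ?c ^ 2" by (intro mult_right_mono) auto
    moreover have "0 \<le> (\<Sum>v\<in>L - T. (p v - ?c) ^ 2)" by (intro sum_nonneg) auto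
    moreover have "\<dots> = (\<Sum>v\<in>L - T. p v ^ 2) - 2 * ?c * S + real (card (L - T)) * ?c ^ 2"
    proof -
      have "(\<Sum>v\<in>L - T. (p v - ?c) ^ 2) = (\<Sum>v\<in>L - T. p v ^ 2 - 2 * ?c * p v + ?c ^ 2)"
        by (intro sum.cong refl) (simp add: power2_eq_square algebra_simps)
      also have "\<dots> = (\<Sum>v\<in>L - T. p v ^ 2) - (\<Sum>v\<in>L - T. 2 * ?c * p v) + real (card (L - T)) * ?c ^ 2"
        by (simp only: sum.distrib sum_subtractf sum_constant)
      also have "(\<Sum>v\<in>L - T. 2 * ?c * p v) = 2 * ?c * S"
        by (simp only: sum_distrib_left S_def)
      finally show ?thesis .
    qed
    moreover have "2 * ?c * S - ?m * ?c ^ 2 = S ^ 2 / ?m"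
      using mpos by (simp add: power2_eq_square field_simps)
    ultimately show ?thesis by linarith
  qed
  \<comment> \<open>\<open>g x\<close> is the weight that \<open>x\<close> sees on its unmet lines; its weighted average is what matters\<close>
  have "(\<Sum>x\<in>U. w x * g x) = (\<Sum>v\<in>L - T. \<Sum>x\<in>{x\<in>U. (v, x) \<in> I}. w x * (p v - w x))"
    unfolding g_def sum_distrib_left swap ..
  also have "\<dots> \<ge> (\<Sum>v\<in>L - T. p v ^ 2 - p v)"
  proof (intro sum_mono)
    fix v
    have "p v ^ 2 - p v = (\<Sum>x\<in>{x\<in>U. (v, x) \<in> I}. w x * (p v - 1))"
      unfolding sum_distrib_right[symmetric] p_def[symmetric] by (simp add: power2_eq_square algebra_simps)
    also have "\<dots> \<le> (\<Sum>x\<in>{x\<in>U. (v, x) \<in> I}. w x * (p v - w x))"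
      using w by (intro sum_mono mult_left_mono) (auto simp: less_imp_le)
    finally show "p v ^ 2 - p v \<le> \<dots>" .
  qed
  finally have "(\<Sum>x\<in>U. w x * g x) \<ge> (\<Sum>v\<in>L - T. p v ^ 2) - S"
    by (simp add: sum_subtractf S_def)
  moreover have "(\<Sum>v\<in>L - T. p v ^ 2) - S \<ge> real a ^ 2 * \<Phi> ^ 2 / (32 * ?m)"
  proof -
    have "8 * ?m \<le> real a * \<Phi> / 4"
      using big a by (simp add: \<Phi>_def w_def field_simps)
    then have 8: "8 * ?m \<le> S" using S_low by linarith
    have "real a ^ 2 * \<Phi> ^ 2 / (32 * ?m) = (real a * \<Phi> / 4) ^ 2 / (2 * ?m)"
      by (simp add: power2_eq_square)
    also have "\<dots> \<le> S ^ 2 / (2 * ?m)"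
      using S_low \<Phi>2 mpos by (intro divide_right_mono power_mono) auto
    also have "\<dots> \<le> S ^ 2 / ?m - S"
      using mpos mult_left_mono[OF 8, of S] 8 by (simp add: field_simps power2_eq_square)
    also have "S ^ 2 / ?m \<le> (\<Sum>v\<in>L - T. p v ^ 2)" by (fact CS)
    finally show ?thesis by simp
  qed
  ultimately have tot: "(\<Sum>x\<in>U. w x * g x) \<ge> real a ^ 2 * \<Phi> ^ 2 / (32 * ?m)" by linarith
  have "\<exists>x\<in>U. g x \<ge> real a ^ 2 * \<Phi> / (32 * ?m)"
  proof (rule ccontr)
    assume "\<not> ?thesis"
    then have "(\<Sum>x\<in>U. w x * g x) < (\<Sum>x\<in>U. w x * (real a ^ 2 * \<Phi> / (32 * ?m)))"
      using ne finU w by (intro sum_strict_mono mult_strict_left_mono) auto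
    also have "\<dots> = real a ^ 2 * \<Phi> ^ 2 / (32 * ?m)"
      unfolding sum_distrib_right[symmetric] \<Phi>_def[symmetric] by (simp add: power2_eq_square)
    finally show False using tot by linarith
  qed
  then obtain x where x: "x \<in> U" "g x \<ge> real a ^ 2 * \<Phi> / (32 * ?m)" by blast
  define c where "c y = card ((?ln x - T) \<inter> ?ln y)" for y
  have g_eq: "g x = (\<Sum>y\<in>U - {x}. w y * real (c y))"
  proof -
    have "g x = (\<Sum>v\<in>?ln x - T. \<Sum>y\<in>{y\<in>U - {x}. (v, y) \<in> I}. w y)"
      unfolding g_def
    proof (intro sum.cong refl)
      fix v assume v: "v \<in> ?ln x - T"
      have "{y\<in>U. (v, y) \<in> I} = insert x {y\<in>U - {x}. (v, y) \<in> I}"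
        using v x(1) by (auto simp: lines_through_def)
      then show "p v - w x = (\<Sum>y\<in>{y\<in>U - {x}. (v, y) \<in> I}. w y)"
        using finU by (simp add: p_def)
    qed
    also have "\<dots> = (\<Sum>y\<in>U - {x}. \<Sum>v\<in>{v\<in>?ln x - T. (v, y) \<in> I}. w y)"
      using finU by (intro sum.swap_restrict) auto
    also have "\<dots> = (\<Sum>y\<in>U - {x}. w y * real (c y))"
    proof (intro sum.cong refl)
      fix y
      have "{v\<in>?ln x - T. (v, y) \<in> I} = (?ln x - T) \<inter> ?ln y" by (auto simp: lines_through_def)
      then show "(\<Sum>v\<in>{v\<in>?ln x - T. (v, y) \<in> I}. w y) = w y * real (c y)"
        by (simp add: c_def mult.commute)
    qed
    finally show ?thesis .
  qed
  have step: "survival I (insert x F) y \<le> w y - w y * real (c y) / 2" if y: "y \<in> U - {x}" for y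
  proof -
    \<comment> \<open>by linearity \<open>c y\<close> is 0 or 1, and \<open>(1/2)^c = 1 - c/2\<close> exactly for these values\<close>
    have "c y \<le> card (?ln x \<inter> ?ln y)" unfolding c_def by (intro card_mono) auto
    then have c1: "c y \<le> 1" using linear[of x y] x(1) y U by force
    have "?ln y \<inter> (\<Union>z\<in>insert x F. ?ln z) = (?ln y \<inter> T) \<union> ((?ln x - T) \<inter> ?ln y)"
      by (auto simp: T_def)
    then have "card (?ln y \<inter> (\<Union>z\<in>insert x F. ?ln z)) = card (?ln y \<inter> T) + c y"
      unfolding c_def by (simp, intro card_Un_disjoint) auto
    then have "survival I (insert x F) y = w y * (1/2) ^ c y"
      by (simp add: survival_def w_def T_def power_add)
    moreover have "c y = 0 \<or> c y = 1" using c1 by linarith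
    ultimately show ?thesis by auto
  qed
  have "sum (survival I (insert x F)) (U - {x}) \<le> (\<Sum>y\<in>U - {x}. w y - w y * real (c y) / 2)"
    using step by (intro sum_mono) auto
  also have "\<dots> = sum w (U - {x}) - g x / 2"
    unfolding g_eq by (simp add: sum_subtractf sum_divide_distrib)
  also have "sum w (U - {x}) \<le> \<Phi>"
    unfolding \<Phi>_def using finU w by (intro sum_mono2) (auto simp: less_imp_le)
  also have "\<Phi> - g x / 2 \<le> \<Phi> - real a ^ 2 * \<Phi> / (32 * ?m) / 2"
    by (intro diff_left_mono divide_right_mono x(2)) simp
  also have "\<dots> = (1 - real a ^ 2 / (64 * ?m)) * \<Phi>" by (simp add: algebra_simps)
  finally show ?thesis using x(1) by (auto simp: \<Phi>_def w_def)
qed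

end

section \<open>Counting independent sets\<close>

context linear_system begin

text \<open>A weighted form of the Kleitman-Winston count. Think of \<open>q S\<close> as the probability that \<open>S\<close> is
independent. A set \<open>R\<close> either avoids the point \<open>x\<close> supplied by lemma \<open>exists_shrinking_point\<close> or contains
it; in the second case \<open>x\<close> joins \<open>F\<close> and the total survival weight shrinks. This can happen at most
\<open>k\<close> times before the weight drops to \<open>D\<close>, and then all remaining points are handled at once by the
bound on elementary symmetric sums. The induction over \<open>U\<close> adds the two cases like Pascal's rule,
which gives the factor \<open>(|U| + 1)^k\<close>.\<close>

lemma sum_independent_weight_le:
  fixes q :: "'p set \<Rightarrow> real" and k r t :: nat
  defines "D \<equiv> 32 * real (card L) / real a"
  defines "\<delta> \<equiv> real a ^ 2 / (64 * real (card L))"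
  assumes a: "a > 0" and na: "real (card B) ^ 2 \<le> 2 ^ a" and \<delta>: "\<delta> \<le> 1"
    and q: "\<And>F R. F \<subseteq> B \<Longrightarrow> R \<subseteq> B \<Longrightarrow> F \<inter> R = {} \<Longrightarrow> q (F \<union> R) \<le> (\<Prod>y\<in>R. survival I F y)"
    and t: "real t \<le> D" and r: "r \<le> t"
    and F: "F \<subseteq> B" and U: "U \<subseteq> B - F" and k: "sum (survival I F) U * (1 - \<delta>) ^ k \<le> D"
  shows "(\<Sum>R\<in>nsets U r. q (F \<union> R)) \<le> real (card U + 1) ^ k * (D ^ t / fact t)"
proof -
  have D0: "D \<ge> 0" by (simp add: D_def)
  have mono: "D ^ r / fact r \<le> D ^ t / fact t" if "r \<le> t" for r
    using that t
  proof (induction rule: inc_induct)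
    case (step r)
    have "real (Suc r) \<le> D" using step by linarith
    then have "real (Suc r) * D ^ r \<le> D * D ^ r" using D0 by (intro mult_right_mono) auto
    then have "real (Suc r) * D ^ r / fact (Suc r) \<le> D ^ Suc r / fact (Suc r)"
      by (intro divide_right_mono) auto
    moreover have "real (Suc r) * D ^ r / fact (Suc r) = D ^ r / fact r"
      by (simp add: fact_Suc del: of_nat_Suc)
    ultimately have "D ^ r / fact r \<le> D ^ Suc r / fact (Suc r)" by simp
    then show ?case using step by simp
  qed simp
  have finU: "finite U" using U finB finite_subset by blast
  show ?thesis using r F U k finU
  proof (induction "card U" arbitrary: U F r k)
    case (0 U F r k)
    then have "U = {}" by simp
    have "(\<Sum>R\<in>nsets U r. q (F \<union> R)) \<le> 1 * (D ^ t / fact t)"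
    proof (cases "r = 0")
      case True
      have "q F \<le> 1" using q[of F "{}"] 0 by simp
      also have "1 \<le> D ^ t / fact t" using mono[of 0] by simp
      finally show ?thesis using True by simp
    next
      case False
      then show ?thesis using \<open>U = {}\<close> D0 by (simp add: nsets_empty_iff)
    qed
    then show ?case using 0 by simp
  next
    case (Suc u U F r k)
    let ?X = "D ^ t / fact t"
    have X0: "?X \<ge> 0" using D0 by simp
    have \<Phi>0: "sum (survival I F) U \<ge> 0"
      by (intro sum_nonneg less_imp_le survival_pos)
    show ?case
    proof (cases "sum (survival I F) U \<le> D")
      case True
      have "(\<Sum>R\<in>nsets U r. q (F \<union> R)) \<le> (\<Sum>R\<in>nsets U r. prod (survival I F) R)"
        using Suc.prems by (intro sum_mono q) (auto simp: nsets_def)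
      also have "\<dots> \<le> sum (survival I F) U ^ r / fact r"
        using Suc.prems by (intro elementary_symmetric_le less_imp_le survival_pos) auto
      also have "\<dots> \<le> D ^ r / fact r"
        using True \<Phi>0 by (intro divide_right_mono power_mono) auto
      also have "\<dots> \<le> 1 * ?X" using mono Suc.prems by simp
      also have "\<dots> \<le> real (card U + 1) ^ k * ?X"
        using X0 by (intro mult_right_mono one_le_power) auto
      finally show ?thesis .
    next
      case False
      then have "k \<noteq> 0" using Suc.prems by (intro notI) simp
      then obtain j where j: "k = Suc j" by (cases k) auto
      have "U \<noteq> {}" using Suc.hyps by auto
      obtain x where x: "x \<in> U" and shrink:
        "sum (survival I (insert x F)) (U - {x}) \<le> (1 - \<delta>) * sum (survival I F) U"
        using exists_shrinking_point[OF a _ \<open>U \<noteq> {}\<close> _ na, of F] False Suc.prems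
        unfolding D_def \<delta>_def by force
      define V where "V = U - {x}"
      have V: "finite V" "x \<notin> V" "U = insert x V" "card V = u"
        using x Suc by (auto simp: V_def)
      have V1: "(\<Sum>R\<in>nsets V r'. q (F \<union> R)) \<le> real (u + 1) ^ k * ?X" if "r' \<le> t" for r'
      proof -
        have "sum (survival I F) V \<le> sum (survival I F) U"
          using V Suc.prems by (intro sum_mono2 less_imp_le survival_pos) auto
        then have "sum (survival I F) V * (1 - \<delta>) ^ k \<le> sum (survival I F) U * (1 - \<delta>) ^ k"
          using \<delta> by (intro mult_right_mono) auto
        also have "\<dots> \<le> D" using Suc.prems by simp
        finally show ?thesis
          using Suc.hyps(1)[of V r' F k] V that Suc.prems by auto
      qed
      have V2: "(\<Sum>R\<in>nsets V r'. q (insert x F \<union> R)) \<le> real (u + 1) ^ j * ?X" if "r' \<le> t" for r'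
      proof -
        have "sum (survival I (insert x F)) V * (1 - \<delta>) ^ j
            \<le> (1 - \<delta>) * sum (survival I F) U * (1 - \<delta>) ^ j"
          using \<delta> shrink unfolding V_def by (intro mult_right_mono) auto
        also have "\<dots> = sum (survival I F) U * (1 - \<delta>) ^ k" by (simp add: j)
        also have "\<dots> \<le> D" using Suc.prems by simp
        finally show ?thesis
          using Suc.hyps(1)[of V r' "insert x F" j] V that Suc.prems by auto
      qed
      show ?thesis
      proof (cases r)
        case 0
        have "(\<Sum>R\<in>nsets U r. q (F \<union> R)) = (\<Sum>R\<in>nsets V r. q (F \<union> R))" using 0 by simp
        also have "\<dots> \<le> real (u + 1) ^ k * ?X" using V1[of r] 0 by (simp only: zero_le)
        also have "\<dots> \<le> real (card U + 1) ^ k * ?X"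
          using Suc.hyps(2) X0 by (intro mult_right_mono power_mono) auto
        finally show ?thesis .
      next
        case (Suc r')
        then have rt: "Suc r' \<le> t" using Suc.prems by simp
        have "(\<Sum>R\<in>nsets U r. q (F \<union> R)) =
            (\<Sum>R\<in>nsets V r. q (F \<union> R)) + (\<Sum>R\<in>nsets V r'. q (insert x F \<union> R))"
          using sum_nsets_Suc_insert[OF V(1,2), of "\<lambda>R. q (F \<union> R)" r'] V(3) Suc by simp
        also have "\<dots> \<le> real (u + 1) ^ k * ?X + real (u + 1) ^ j * ?X"
          using V1[of r] V2[of r'] rt Suc by (intro add_mono) auto
        also have "\<dots> = (real (u + 2) * real (u + 1) ^ j) * ?X"
          by (simp add: j algebra_simps)
        also have "\<dots> \<le> (real (u + 2) * real (u + 2) ^ j) * ?X"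
          using X0 by (intro mult_right_mono mult_left_mono power_mono) auto
        also have "\<dots> = real (card U + 1) ^ k * ?X"
          using \<open>Suc u = card U\<close>[symmetric] by (simp add: j)
        finally show ?thesis .
      qed
    qed
  qed
qed

end

section \<open>Random two-colourings of the lines\<close>

text \<open>A set \<open>\<chi>\<close> of incidences two-colours the points of each line: the points \<open>y\<close> with \<open>(v, y) \<in> \<chi>\<close> form
one colour class of the line \<open>v\<close>. Two points are adjacent if some line contains both of them in
different classes, so that every line carries a complete bipartite graph.\<close>

definition colour_adj :: "('v \<times> 'p) set \<Rightarrow> ('v \<times> 'p) set \<Rightarrow> 'p \<Rightarrow> 'p \<Rightarrow> bool" where
  "colour_adj I \<chi> x y \<longleftrightarrow> (\<exists>v. (v, x) \<in> I \<and> (v, y) \<in> I \<and> ((v, x) \<in> \<chi>) \<noteq> ((v, y) \<in> \<chi>))"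

context linear_system begin

lemma finite_I: "finite I"
  using I_sub finL finB finite_subset by blast

text \<open>If \<open>F \<union> R\<close> is independent, the colour of a point \<open>y \<in> R\<close> on a line that meets \<open>F\<close> is forced by a
point of \<open>F\<close> on that line. Hence the colouring is determined by its values off the set \<open>J\<close> of these
forced incidences.\<close>

lemma card_colourings_indep_le:
  assumes F: "F \<subseteq> B" and R: "R \<subseteq> B" and FR: "F \<inter> R = {}"
  shows "real (card {\<chi> \<in> Pow I. \<forall>x\<in>F \<union> R. \<forall>y\<in>F \<union> R. \<not> colour_adj I \<chi> x y})
    \<le> 2 ^ card I * (\<Prod>y\<in>R. survival I F y)"
proof -
  let ?C = "{\<chi> \<in> Pow I. \<forall>x\<in>F \<union> R. \<forall>y\<in>F \<union> R. \<not> colour_adj I \<chi> x y}"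
  let ?T = "\<Union>z\<in>F. lines_through I z"
  define J where "J = {(v, y). y \<in> R \<and> v \<in> lines_through I y \<inter> ?T}"
  have finR: "finite R" using R finB finite_subset by blast
  have J_sub: "J \<subseteq> I" by (auto simp: J_def lines_through_def)
  have inj: "inj_on (\<lambda>\<chi>. \<chi> - J) ?C"
  proof (rule inj_onI)
    fix \<chi> \<chi>' assume c: "\<chi> \<in> ?C" "\<chi>' \<in> ?C" and eq: "\<chi> - J = \<chi>' - J"
    have "(v, y) \<in> \<chi> \<longleftrightarrow> (v, y) \<in> \<chi>'" if vy: "(v, y) \<in> J" for v y
    proof -
      obtain z where z: "z \<in> F" "(v, z) \<in> I" and y: "y \<in> R" "(v, y) \<in> I"
        using vy by (auto simp: J_def lines_through_def)
      have "(v, z) \<notin> J" using z FR by (auto simp: J_def)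
      then have "(v, z) \<in> \<chi> \<longleftrightarrow> (v, z) \<in> \<chi>'" using eq by blast
      moreover have "(v, y) \<in> \<chi> \<longleftrightarrow> (v, z) \<in> \<chi>"
        using c(1) z y by (auto simp: colour_adj_def)
      moreover have "(v, y) \<in> \<chi>' \<longleftrightarrow> (v, z) \<in> \<chi>'"
        using c(2) z y by (auto simp: colour_adj_def)
      ultimately show ?thesis by simp
    qed
    moreover have "z \<in> \<chi> \<longleftrightarrow> z \<in> \<chi>'" if "z \<notin> J" for z
      using eq that by (metis DiffI DiffD1)
    ultimately show "\<chi> = \<chi>'" by (intro set_eqI) (metis surj_pair)
  qed
  have "card ?C \<le> card (Pow (I - J))"
    using finite_I by (intro card_inj_on_le[OF inj]) auto
  also have "\<dots> = 2 ^ card (I - J)" using finite_I by (simp add: card_Pow)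
  finally have "real (card ?C) \<le> real (2 ^ card (I - J))"
    by (simp only: of_nat_le_iff)
  also have "real (2 ^ card (I - J)) = 2 ^ card (I - J)" by simp
  also have "(2::real) ^ card (I - J) = 2 ^ card I * (1 / 2) ^ card J"
  proof -
    have "card I = card (I - J) + card J"
      using finite_I J_sub card_mono[OF finite_I J_sub] by (simp add: card_Diff_subset finite_subset)
    then show ?thesis by (simp add: power_add power_divide)
  qed
  also have "card J = (\<Sum>y\<in>R. card (lines_through I y \<inter> ?T))"
  proof -
    have "J = (\<lambda>(y, v). (v, y)) ` (SIGMA y:R. lines_through I y \<inter> ?T)"
      by (auto simp: J_def image_def)
    moreover have "inj_on (\<lambda>(y, v). (v, y)) (SIGMA y:R. lines_through I y \<inter> ?T)"
      by (auto simp: inj_on_def)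
    ultimately show ?thesis using finR by (simp add: card_image)
  qed
  finally show ?thesis by (simp add: survival_def power_sum)
qed

lemma power_self_le_fact: "real t ^ t \<le> 3 ^ t * fact t"
proof (induction t)
  case (Suc t)
  have "real (Suc t) ^ t \<le> 3 * real t ^ t"
  proof (cases "t = 0")
    case False
    have "(1 + 1 / real t) ^ t \<le> exp (1 / real t) ^ t"
      by (intro power_mono exp_ge_add_one_self) auto
    also have "\<dots> = exp 1" using False by (simp add: exp_of_nat_mult[symmetric])
    also have "\<dots> \<le> 3" by (rule exp_le)
    finally have "real t ^ t * (1 + 1 / real t) ^ t \<le> real t ^ t * 3" by (intro mult_left_mono) auto
    also have "real t ^ t * (1 + 1 / real t) ^ t = real (Suc t) ^ t"
      using False by (simp add: power_mult_distrib[symmetric] field_simps)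
    finally show ?thesis by simp
  qed simp
  then have "real (Suc t) * real (Suc t) ^ t \<le> real (Suc t) * (3 * real t ^ t)"
    by (intro mult_left_mono) auto
  also have "\<dots> \<le> real (Suc t) * (3 * (3 ^ t * fact t))"
    using Suc by (intro mult_left_mono) auto
  finally show ?case by (simp add: algebra_simps)
qed simp

text \<open>First moment argument over pairs of a colouring \<open>\<chi>\<close> and a set \<open>W\<close> of \<open>N\<close> points. The expected number
of independent sets of order \<open>t\<close> inside \<open>W\<close> is below 1, because on average the colourings leave at most
\<open>2^t D^t / t!\<close> such sets, where \<open>D = 32 |L| / a\<close>, and a fraction of at most
\<open>(N choose t) / (|B| choose t)\<close> of the sets \<open>W\<close> contains a given one.\<close>

theorem exists_colouring_and_sample:
  fixes k t N :: nat
  assumes a: "a > 0" and na: "real (card B) ^ 2 \<le> 2 ^ a" and \<delta>: "real a ^ 2 \<le> 64 * real (card L)"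
    and L: "card L > 0"
    and t: "real t \<le> 32 * real (card L) / real a" and t0: "t > 0"
    and k: "real (card B) * (1 - real a ^ 2 / (64 * real (card L))) ^ k \<le> 32 * real (card L) / real a"
    and kt: "real (card B + 1) ^ k \<le> 2 ^ t"
    and N: "18 * (32 * real (card L) / real a) * real N < real t * real (card B)"
    and NB: "N \<le> card B" and tB: "t \<le> card B"
  shows "\<exists>\<chi> W. \<chi> \<subseteq> I \<and> W \<subseteq> B \<and> card W = N \<and>
    (\<forall>S\<subseteq>W. card S = t \<longrightarrow> (\<exists>x\<in>S. \<exists>y\<in>S. colour_adj I \<chi> x y))"
proof (rule ccontr)
  assume contra: "\<not> ?thesis"
  have neg: "\<exists>S\<subseteq>W. card S = t \<and> (\<forall>x\<in>S. \<forall>y\<in>S. \<not> colour_adj I \<chi> x y)"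
    if "\<chi> \<subseteq> I" "W \<subseteq> B" "card W = N" for \<chi> W
  proof (rule ccontr)
    assume "\<not> ?thesis"
    then have "\<forall>S\<subseteq>W. card S = t \<longrightarrow> (\<exists>x\<in>S. \<exists>y\<in>S. colour_adj I \<chi> x y)" by simp
    with that have "\<exists>\<chi> W. \<chi> \<subseteq> I \<and> W \<subseteq> B \<and> card W = N \<and>
        (\<forall>S\<subseteq>W. card S = t \<longrightarrow> (\<exists>x\<in>S. \<exists>y\<in>S. colour_adj I \<chi> x y))"
      by (intro exI[of _ \<chi>] exI[of _ W] conjI)
    with contra show False by (rule notE)
  qed
  define D where "D = 32 * real (card L) / real a"
  let ?n = "card B"
  let ?ind = "\<lambda>\<chi> S. \<forall>x\<in>S. \<forall>y\<in>S. \<not> colour_adj I \<chi> x y"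
  define q where "q S = real (card {\<chi> \<in> Pow I. ?ind \<chi> S}) / 2 ^ card I" for S
  have q: "q (F \<union> R) \<le> (\<Prod>y\<in>R. survival I F y)" if "F \<subseteq> B" "R \<subseteq> B" "F \<inter> R = {}" for F R
    using card_colourings_indep_le[OF that] by (simp add: q_def field_simps)
  have n0: "?n > 0" using t0 tB by simp
  have D0: "D > 0" using a L by (simp add: D_def)
  have Q: "(\<Sum>S\<in>nsets B t. q S) \<le> 2 ^ t * (D ^ t / fact t)"
  proof -
    have "sum (survival I {}) B = real ?n" by (simp add: survival_def)
    then have "(\<Sum>S\<in>nsets B t. q ({} \<union> S)) \<le> real (?n + 1) ^ k * (D ^ t / fact t)"
      unfolding D_def using a na \<delta> L t k q by (intro sum_independent_weight_le) auto
    also have "\<dots> \<le> 2 ^ t * (D ^ t / fact t)"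
      using kt D0 by (intro mult_right_mono) auto
    finally show ?thesis by simp
  qed
  have tN: "t \<le> N"
  proof (rule ccontr)
    assume "\<not> t \<le> N"
    obtain W where W: "W \<subseteq> B" "card W = N" using NB obtain_subset_with_card_n by metis
    have "card S \<noteq> t" if "S \<subseteq> W" for S
      using card_mono[OF finite_subset[OF W(1) finB] that] W(2) \<open>\<not> t \<le> N\<close> by simp
    then show False using neg[OF _ W, of "{}"] by auto
  qed
  \<comment> \<open>the triples \<open>(S, \<chi>, W)\<close> with \<open>S\<close> independent for \<open>\<chi>\<close> and contained in \<open>W\<close>, counted in two ways\<close>
  define Bad where "Bad = (SIGMA S:nsets B t. {\<chi> \<in> Pow I. ?ind \<chi> S} \<times> {W \<in> nsets B N. S \<subseteq> W})"
  have finBad: "finite Bad"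
    unfolding Bad_def using finite_I finB
    by (intro finite_SigmaI finite_cartesian_product finite_Collect_conjI disjI1)
       (auto simp: finite_imp_finite_nsets Pow_def[symmetric])
  have "Pow I \<times> nsets B N \<subseteq> snd ` Bad"
  proof
    fix z assume "z \<in> Pow I \<times> nsets B N"
    then obtain \<chi> W where z: "z = (\<chi>, W)" "\<chi> \<subseteq> I" "W \<in> nsets B N" by auto
    then have W: "W \<subseteq> B" "card W = N" by (auto simp: nsets_def)
    then obtain S where S: "S \<subseteq> W" "card S = t" "?ind \<chi> S"
      using neg[OF z(2)] by metis
    have "finite S" using S t0 card_ge_0_finite by blast
    then have "(S, z) \<in> Bad" using z S W by (auto simp: Bad_def nsets_def)
    then show "z \<in> snd ` Bad" by force
  qed
  then have "card (Pow I \<times> nsets B N) \<le> card Bad"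
    using finBad surj_card_le by blast
  then have "2 ^ card I * (?n choose N) \<le> card Bad"
    using finite_I by (simp add: card_cartesian_product card_Pow)
  also have "card Bad = (\<Sum>S\<in>nsets B t. card {\<chi> \<in> Pow I. ?ind \<chi> S} * ((?n - t) choose (N - t)))"
  proof -
    have "card {W \<in> nsets B N. S \<subseteq> W} = (?n - t) choose (N - t)" if S: "S \<in> nsets B t" for S
    proof -
      have fS: "finite S" "S \<subseteq> B" "card S = t" using S by (auto simp: nsets_def)
      have "bij_betw (\<lambda>W. W - S) {W \<in> nsets B N. S \<subseteq> W} (nsets (B - S) (N - t))"
      proof (intro bij_betwI[where g = "\<lambda>W. W \<union> S"])
        show "(\<lambda>W. W - S) \<in> {W \<in> nsets B N. S \<subseteq> W} \<rightarrow> nsets (B - S) (N - t)"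
          using fS by (auto simp: nsets_def card_Diff_subset)
        show "(\<lambda>W. W \<union> S) \<in> nsets (B - S) (N - t) \<rightarrow> {W \<in> nsets B N. S \<subseteq> W}"
        proof
          fix W assume "W \<in> nsets (B - S) (N - t)"
          then have W: "W \<subseteq> B - S" "finite W" "card W = N - t" by (auto simp: nsets_def)
          then have "card (W \<union> S) = N" using fS tN by (subst card_Un_disjoint) auto
          then show "W \<union> S \<in> {W \<in> nsets B N. S \<subseteq> W}" using W fS by (auto simp: nsets_def)
        qed
      qed (auto simp: nsets_def)
      then have "card {W \<in> nsets B N. S \<subseteq> W} = card (nsets (B - S) (N - t))" by (rule bij_betw_same_card)
      then show ?thesis using fS by (simp add: card_Diff_subset)
    qed
    then show ?thesis
      unfolding Bad_def using finite_I finB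
      by (subst card_SigmaI) (auto simp: card_cartesian_product finite_imp_finite_nsets intro!: sum.cong)
  qed
  finally have "2 ^ card I * (?n choose N)
      \<le> (\<Sum>S\<in>nsets B t. card {\<chi> \<in> Pow I. ?ind \<chi> S} * ((?n - t) choose (N - t)))" .
  then have "real (2 ^ card I * (?n choose N))
      \<le> real (\<Sum>S\<in>nsets B t. card {\<chi> \<in> Pow I. ?ind \<chi> S} * ((?n - t) choose (N - t)))"
    by (simp only: of_nat_le_iff)
  also have "\<dots> = 2 ^ card I * (\<Sum>S\<in>nsets B t. q S) * real ((?n - t) choose (N - t))"
    by (simp add: q_def sum_divide_distrib[symmetric] sum_distrib_right)
  finally have "real (?n choose N) \<le> (\<Sum>S\<in>nsets B t. q S) * real ((?n - t) choose (N - t))"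
    by simp
  also have "\<dots> \<le> 2 ^ t * (D ^ t / fact t) * real ((?n - t) choose (N - t))"
    using Q by (intro mult_right_mono) auto
  finally have "real (?n choose N) \<le> 2 ^ t * (D ^ t / fact t) * real ((?n - t) choose (N - t))" .
  then have "real (?n choose N) * real (N choose t)
      \<le> 2 ^ t * (D ^ t / fact t) * real ((?n - t) choose (N - t)) * real (N choose t)"
    by (rule mult_right_mono) simp
  also have "real (?n choose N) * real (N choose t) = real (?n choose t) * real ((?n - t) choose (N - t))"
    using choose_mult[OF tN NB] by (simp only: of_nat_mult[symmetric])
  also have "2 ^ t * (D ^ t / fact t) * real ((?n - t) choose (N - t)) * real (N choose t) =
      2 ^ t * (D ^ t / fact t) * real (N choose t) * real ((?n - t) choose (N - t))"
    by (simp only: mult.assoc mult.commute[of "real (N choose t)"])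
  finally have "real (?n choose t) \<le> 2 ^ t * (D ^ t / fact t) * real (N choose t)"
    using NB by (elim mult_right_le_imp_le) simp
  also have "\<dots> \<le> 2 ^ t * (D ^ t / fact t) * (real N ^ t / fact t)"
  proof (rule mult_left_mono)
    have "real ((N choose t) * fact t) \<le> real (N ^ t)"
      using binomial_fact_pow[of N t] by (simp only: of_nat_le_iff)
    then show "real (N choose t) \<le> real N ^ t / fact t" by (simp add: field_simps)
  qed (use D0 in simp)
  also have "2 ^ t * (D ^ t / fact t) * (real N ^ t / fact t) = (2 * D * real N) ^ t / fact t ^ 2"
    by (simp add: power_mult_distrib power2_eq_square)
  also have "\<dots> \<le> (2 * D * real N) ^ t / ((real t / 3) ^ t) ^ 2"
  proof (intro divide_left_mono power_mono)
    show "(real t / 3) ^ t \<le> fact t"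
      using power_self_le_fact[of t] by (simp add: power_divide field_simps)
  qed (use D0 t0 in auto)
  also have "\<dots> = (18 * D * real N / real t ^ 2) ^ t"
  proof -
    have "18 * D * real N / real t ^ 2 = (2 * D * real N) / (real t / 3) ^ 2"
      by (simp add: power_divide)
    moreover have "((real t / 3) ^ t) ^ 2 = ((real t / 3) ^ 2) ^ t"
      by (simp only: power_mult[symmetric] mult.commute)
    ultimately show ?thesis by (simp only: power_divide)
  qed
  finally have up: "real (?n choose t) \<le> (18 * D * real N / real t ^ 2) ^ t" .
  have "(18 * D * real N / real t ^ 2) ^ t < (real ?n / real t) ^ t"
  proof (rule power_strict_mono)
    have "18 * D * real N / real t ^ 2 < real t * real ?n / real t ^ 2"
      using N t0 unfolding D_def[symmetric] by (intro divide_strict_right_mono) auto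
    then show "18 * D * real N / real t ^ 2 < real ?n / real t"
      using t0 by (simp add: power2_eq_square)
  qed (use D0 t0 in auto)
  also have "\<dots> \<le> real (?n choose t)"
    using binomial_ge_n_over_k_pow_k[OF tB, where 'a = real] by simp
  finally show False using up by linarith
qed

end

section \<open>Odd cycles and girth\<close>

text \<open>The graph on \<open>W\<close> whose edges are the pairs of points in different colour classes of a common line.\<close>

definition colour_graph :: "('v \<times> 'p) set \<Rightarrow> ('v \<times> 'p) set \<Rightarrow> 'p set \<Rightarrow> 'p graph" where
  "colour_graph I \<chi> W = \<lparr>verts = W, edges = {{x, y} | x y. x \<in> W \<and> y \<in> W \<and> colour_adj I \<chi> x y}\<rparr>"

lemma colour_adj_irrefl: "\<not> colour_adj I \<chi> x x"
  by (simp add: colour_adj_def)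

lemma colour_adj_sym: "colour_adj I \<chi> x y \<longleftrightarrow> colour_adj I \<chi> y x"
  by (auto simp: colour_adj_def)

lemma edge_colour_graph_iff:
  "{x, y} \<in> edges (colour_graph I \<chi> W) \<longleftrightarrow> x \<in> W \<and> y \<in> W \<and> colour_adj I \<chi> x y"
  by (auto simp: colour_graph_def doubleton_eq_iff colour_adj_sym)

lemma simple_colour_graph: "finite W \<Longrightarrow> simple_graph (colour_graph I \<chi> W)"
  using colour_adj_irrefl by (fastforce simp: simple_graph_def colour_graph_def)

text \<open>A closed walk \<open>x\<^sub>0, v\<^sub>0, x\<^sub>1, v\<^sub>1, ...\<close> alternating between points and lines, given as the list of the
pairs \<open>(x\<^sub>i, v\<^sub>i)\<close>: the line \<open>v\<^sub>i\<close> contains \<open>x\<^sub>i\<close> and the next point, cyclically. Repetitions are allowed.\<close>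

definition berge_closed :: "('v \<times> 'p) set \<Rightarrow> ('p \<times> 'v) list \<Rightarrow> bool" where
  "berge_closed I ps \<longleftrightarrow> ps \<noteq> [] \<and> (\<forall>p\<in>set ps. (snd p, fst p) \<in> I) \<and>
    successively (\<lambda>p q. (snd p, fst q) \<in> I) ps \<and> (snd (last ps), fst (hd ps)) \<in> I"

lemma berge_closed_nth:
  assumes "berge_closed I ps" "i < length ps"
  shows "(snd (ps ! i), fst (ps ! i)) \<in> I" "(snd (ps ! i), fst (ps ! (Suc i mod length ps))) \<in> I"
proof -
  show "(snd (ps ! i), fst (ps ! i)) \<in> I" using assms by (simp add: berge_closed_def)
  show "(snd (ps ! i), fst (ps ! (Suc i mod length ps))) \<in> I"
  proof (cases "Suc i = length ps")
    case True
    then have "ps ! i = last ps" "ps ! 0 = hd ps"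
      using assms by (auto simp: berge_closed_def last_conv_nth hd_conv_nth simp flip: True)
    then show ?thesis using assms True by (simp add: berge_closed_def)
  next
    case False
    then show ?thesis using assms successively_nth[of "\<lambda>p q. (snd p, fst q) \<in> I" ps i] by (simp add: berge_closed_def)
  qed
qed

lemma has_copy_cycle_of_berge_closed:
  assumes disj: "A \<inter> B = {}"
    and I: "I \<subseteq> A \<times> B" "\<And>v y. (v, y) \<in> I \<Longrightarrow> {v, y} \<in> edges G" and AB: "A \<union> B \<subseteq> verts G"
    and ps: "berge_closed I ps" "distinct (map fst ps)" "distinct (map snd ps)" "length ps \<ge> 2"
  shows "has_copy (cycle_graph (2 * length ps)) G"
proof -
  let ?s = "length ps"
  define f where "f j = (if even j then fst (ps ! (j div 2)) else snd (ps ! (j div 2)))" for j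
  have f0: "f (2 * i) = fst (ps ! i)" and f1: "f (Suc (2 * i)) = snd (ps ! i)" for i
    by (simp_all add: f_def)
  have mem: "fst (ps ! i) \<in> B" "snd (ps ! i) \<in> A" if "i < ?s" for i
    using berge_closed_nth(1)[OF ps(1) that] I(1) by auto
  have div: "j div 2 < ?s" if "j < 2 * ?s" for j using that by simp
  show ?thesis
  proof (rule has_copyI)
    show "simple_graph (cycle_graph (2 * ?s))" using ps(4) by (intro simple_cycle_graph) simp
    show "inj_on f (verts (cycle_graph (2 * ?s)))"
    proof (rule inj_onI)
      fix i j assume "i \<in> verts (cycle_graph (2 * ?s))" "j \<in> verts (cycle_graph (2 * ?s))"
        and eq: "f i = f j"
      then have ij: "i div 2 < ?s" "j div 2 < ?s" by (auto simp: cycle_graph_def)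
      have par: "even i \<longleftrightarrow> even j"
        using eq mem[OF ij(1)] mem[OF ij(2)] disj by (auto simp: f_def split: if_splits)
      have "i div 2 = j div 2"
      proof (cases "even i")
        case True
        then show ?thesis using eq par ps(2) ij by (simp add: f_def distinct_conv_nth) metis
      next
        case False
        then show ?thesis using eq par ps(3) ij by (simp add: f_def distinct_conv_nth) metis
      qed
      then show "i = j" using par by (metis even_two_times_div_two odd_two_times_div_two_succ)
    qed
    show "f ` verts (cycle_graph (2 * ?s)) \<subseteq> verts G"
    proof
      fix x assume "x \<in> f ` verts (cycle_graph (2 * ?s))"
      then obtain j where "j < 2 * ?s" "x = f j" by (auto simp: cycle_graph_def)
      then show "x \<in> verts G" using mem[of "j div 2"] AB by (auto simp: f_def)
    qed
    fix e assume "e \<in> edges (cycle_graph (2 * ?s))"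
    then obtain j where j: "j < 2 * ?s" and e: "e = {j, Suc j mod (2 * ?s)}"
      by (auto simp: cycle_graph_def)
    define i where "i = j div 2"
    have i: "i < ?s" using j by (simp add: i_def)
    show "f ` e \<in> edges G"
    proof (cases "even j")
      case True
      then have "j = 2 * i" by (simp add: i_def)
      then have "f ` e = {snd (ps ! i), fst (ps ! i)}" using i by (auto simp: e f0 f1)
      then show ?thesis using I(2) berge_closed_nth(1)[OF ps(1) i] by simp
    next
      case False
      then have "j = Suc (2 * i)" by (simp add: i_def)
      moreover have "Suc (Suc (2 * i)) mod (2 * ?s) = 2 * (Suc i mod ?s)"
        by (metis mult_2_right mult_Suc_right mult_mod_right add_2_eq_Suc)
      ultimately have "f ` e = {snd (ps ! i), fst (ps ! (Suc i mod ?s))}" by (auto simp: e f0 f1)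
      then show ?thesis using I(2) berge_closed_nth(2)[OF ps(1) i] by simp
    qed
  qed
qed

text \<open>In the absence of short cycles, a short closed walk with distinct points stays on one line. If its
lines are distinct, it is a cycle of the bipartite graph unless it has length one. Otherwise a
repeated line splits it into two shorter closed walks that share this line.\<close>

lemma berge_closed_same_line:
  assumes disj: "A \<inter> B = {}"
    and I: "I \<subseteq> A \<times> B" "\<And>v y. (v, y) \<in> I \<Longrightarrow> {v, y} \<in> edges G" and AB: "A \<union> B \<subseteq> verts G"
    and no_cycle: "\<And>s. 2 \<le> s \<Longrightarrow> s \<le> K \<Longrightarrow> \<not> has_copy (cycle_graph (2 * s)) G"
    and ps: "berge_closed I ps" "distinct (map fst ps)" "length ps \<le> K"
    and pq: "p \<in> set ps" "q \<in> set ps"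
  shows "snd p = snd q"
  using ps pq
proof (induction "length ps" arbitrary: ps p q rule: less_induct)
  case less
  show ?case
  proof (cases "distinct (map snd ps)")
    case True
    have "\<not> 2 \<le> length ps"
      using has_copy_cycle_of_berge_closed[OF disj I AB less.prems(1,2) True] no_cycle less.prems(3) by blast
    moreover have "ps \<noteq> []" using less.prems(1) by (simp add: berge_closed_def)
    ultimately obtain r where "ps = [r]" by (cases ps; cases "tl ps") auto
    then show ?thesis using less.prems by simp
  next
    case False
    then obtain us ms ws v where "map snd ps = us @ [v] @ ms @ [v] @ ws"
      using not_distinct_decomp by blast
    then obtain us' x ms' y ws' where ps_eq: "ps = us' @ [(x, v)] @ ms' @ [(y, v)] @ ws'"
      by (auto simp: map_eq_append_conv map_eq_Cons_conv append_eq_map_conv Cons_eq_map_conv)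
    let ?ps1 = "ms' @ [(y, v)]" and ?ps2 = "us' @ [(x, v)] @ ws'"
    have c1: "berge_closed I ?ps1"
      using less.prems(1) unfolding ps_eq berge_closed_def
      by (cases ms') (auto simp: successively_append_iff successively_Cons hd_append split: if_splits)
    have c2: "berge_closed I ?ps2"
      using less.prems(1) unfolding ps_eq berge_closed_def
      by (cases us'; cases ws')
         (auto simp: successively_append_iff successively_Cons hd_append split: if_splits)
    have 1: "snd r = v" if "r \<in> set ?ps1" for r
      by (rule less.hyps[OF _ c1 _ _ that, of "(y, v)", simplified snd_conv])
         (use less.prems(2,3) in \<open>auto simp: ps_eq\<close>)
    have 2: "snd r = v" if "r \<in> set ?ps2" for r
      by (rule less.hyps[OF _ c2 _ _ that, of "(x, v)", simplified snd_conv])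
         (use less.prems(2,3) in \<open>auto simp: ps_eq\<close>)
    have "set ps = set ?ps1 \<union> set ?ps2" unfolding ps_eq by auto
    then show ?thesis using less.prems(4,5) 1 2 by blast
  qed
qed

text \<open>All edges of an odd cycle would lie on one line, where the colours alternate along the cycle.\<close>

lemma colour_graph_odd_cycle_free:
  assumes same_line: "\<And>ps p q. berge_closed I ps \<Longrightarrow> distinct (map fst ps) \<Longrightarrow> length ps \<le> k \<Longrightarrow>
      p \<in> set ps \<Longrightarrow> q \<in> set ps \<Longrightarrow> snd p = snd q"
    and k: "odd k" "k \<ge> 3"
  shows "\<not> has_copy (cycle_graph k) (colour_graph I \<chi> W)"
proof
  assume "has_copy (cycle_graph k) (colour_graph I \<chi> W)"
  then obtain H f where H: "subgraph H (colour_graph I \<chi> W)" and f: "bij_betw f {..<k} (verts H)"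
    and eH: "edges H = (\<lambda>e. f ` e) ` edges (cycle_graph k)"
    by (auto simp: has_copy_def isomorphic_def cycle_graph_def)
  have adj: "colour_adj I \<chi> (f i) (f (Suc i mod k))" if "i < k" for i
  proof -
    have "f ` {i, Suc i mod k} \<in> edges H"
      unfolding eH using that by (intro imageI) (simp add: cycle_graph_def)
    then have "{f i, f (Suc i mod k)} \<in> edges (colour_graph I \<chi> W)"
      using H by (auto simp: subgraph_def)
    then show ?thesis by (simp add: edge_colour_graph_iff)
  qed
  then obtain v where v: "\<And>i. i < k \<Longrightarrow> (v i, f i) \<in> I" "\<And>i. i < k \<Longrightarrow> (v i, f (Suc i mod k)) \<in> I"
    "\<And>i. i < k \<Longrightarrow> ((v i, f i) \<in> \<chi>) \<noteq> ((v i, f (Suc i mod k)) \<in> \<chi>)"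
    unfolding colour_adj_def by metis
  define ps where "ps = map (\<lambda>i. (f i, v i)) [0..<k]"
  have len: "length ps = k" by (simp add: ps_def)
  have "berge_closed I ps"
    unfolding berge_closed_def
  proof (intro conjI)
    show "ps \<noteq> []" using len k by auto
    show "\<forall>p\<in>set ps. (snd p, fst p) \<in> I" using v(1) by (auto simp: ps_def)
    have "(v i, f (Suc i)) \<in> I" if "Suc i < k" for i using v(2)[of i] that by simp
    then show "successively (\<lambda>p q. (snd p, fst q) \<in> I) ps"
      by (auto simp: successively_conv_nth ps_def)
    have "(v (k - 1), f 0) \<in> I" using v(2)[of "k - 1"] k by simp
    then show "(snd (last ps), fst (hd ps)) \<in> I"
      using k by (simp add: ps_def last_map hd_map)
  qed
  moreover have "distinct (map fst ps)"
    using f by (simp add: ps_def distinct_map comp_def bij_betw_def lessThan_atLeast0)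
  ultimately have const: "snd p = snd q" if "p \<in> set ps" "q \<in> set ps" for p q
    by (rule same_line[OF _ _ _ that]) (simp add: len)
  have v0: "v i = v 0" if "i < k" for i
    using const[of "(f i, v i)" "(f 0, v 0)"] that k by (auto simp: ps_def)
  have alt: "((v 0, f i) \<in> \<chi>) = (((v 0, f 0) \<in> \<chi>) \<noteq> odd i)" if "i < k" for i
    using that
  proof (induction i)
    case (Suc i)
    then show ?case using v(3)[of i] v0[of i] by auto
  qed simp
  show False using alt[of "k - 1"] v(3)[of "k - 1"] v0[of "k - 1"] k by auto
qed

text \<open>The least \<open>N\<close> in the definition of the Ramsey number is compared with \<open>|H|\<close> by passing to an induced
subgraph of \<open>H\<close> on \<open>N\<close> vertices, which inherits both properties.\<close>

lemma ramsey_number_gt: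
  fixes F :: "'a graph" and H :: "'b graph"
  assumes F: "simple_graph F" and H: "simple_graph H"
    and free: "\<not> has_copy F H" and indep: "\<not> has_indep_set H t"
  shows "ramsey_number F t > card (verts H)"
proof (rule ccontr)
  let ?P = "\<lambda>N. \<forall>G :: nat graph. simple_graph G \<and> card (verts G) = N \<and> \<not> has_copy F G \<longrightarrow> has_indep_set G t"
  define N where "N = ramsey_number F t"
  assume "\<not> ?thesis"
  then have "N \<le> card (verts H)" by (simp add: N_def)
  then obtain W where W: "W \<subseteq> verts H" "card W = N" by (meson obtain_subset_with_card_n)
  have finW: "finite W" using W H finite_subset by (auto simp: simple_graph_def)
  have "?P N" unfolding N_def ramsey_number_def by (rule LeastI_ex) (rule ramsey_number_exists[OF F])
  obtain g where g: "bij_betw g {..<N} W"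
    using finite_same_card_bij[of "{..<N}" W] finW W(2) by auto
  have g_inj: "inj_on g {..<N}" and g_im: "g ` {..<N} = W" using g by (auto simp: bij_betw_def)
  define G :: "nat graph" where "G = \<lparr>verts = {..<N}, edges = {{i, j} | i j. i < N \<and> j < N \<and> {g i, g j} \<in> edges H}\<rparr>"
  have no_loop: "{x} \<notin> edges H" for x using H by (auto simp: simple_graph_def nsets_def)
  have G: "simple_graph G" using no_loop by (fastforce simp: simple_graph_def G_def)
  have edge: "{i, j} \<in> edges G \<longleftrightarrow> i < N \<and> j < N \<and> {g i, g j} \<in> edges H" for i j
    by (auto simp: G_def doubleton_eq_iff insert_commute)
  have "\<not> has_copy F G"
  proof
    assume "has_copy F G"
    then obtain K f where K: "subgraph K G" and f: "bij_betw f (verts F) (verts K)"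
      and eK: "edges K = (\<lambda>e. f ` e) ` edges F"
      by (auto simp: has_copy_def isomorphic_def)
    have f_sub: "f ` verts F \<subseteq> {..<N}" using f K by (auto simp: subgraph_def G_def bij_betw_def)
    have "has_copy F H"
    proof (rule has_copyI[OF F, of "g \<circ> f"])
      show "inj_on (g \<circ> f) (verts F)"
        using f f_sub g_inj by (intro comp_inj_on) (auto simp: bij_betw_def intro: inj_on_subset)
      show "(g \<circ> f) ` verts F \<subseteq> verts H" using f_sub g_im W(1) by force
      fix e assume e: "e \<in> edges F"
      then have "e \<in> nsets (verts F) 2" using F by (auto simp: simple_graph_def)
      then obtain x y where xy: "e = {x, y}" by (elim nsets2_E) auto
      have "f ` e \<in> edges G" using eK K e by (auto simp: subgraph_def)
      then show "(g \<circ> f) ` e \<in> edges H" by (simp add: xy edge)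
    qed
    then show False using free by simp
  qed
  then have "has_indep_set G t" using \<open>?P N\<close> G by (auto simp: G_def)
  then obtain S where S: "S \<subseteq> {..<N}" "card S = t" "Ramsey.indep S (edges G)"
    by (auto simp: has_indep_set_def G_def)
  have "card (g ` S) = t" using S g_inj by (metis card_image inj_on_subset)
  moreover have "Ramsey.indep (g ` S) (edges H)"
    using S by (force simp: indep_def edge)
  moreover have "g ` S \<subseteq> verts H" using S(1) W(1) g_im by (metis image_mono order_trans)
  ultimately have "has_indep_set H t"
    unfolding has_indep_set_def by (intro exI[of _ "g ` S"] conjI)
  then show False using indep by simp
qed

section \<open>Incidence systems of biregular graphs\<close>

text \<open>The additional properties of the incidence system of a biregular graph of large girth: every line has
\<open>b\<close> points, and closed walks with at most \<open>K\<close> distinct points stay on one line.\<close>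

locale high_girth_system = linear_system +
  fixes b K :: nat
  assumes card_points: "\<And>v. v \<in> L \<Longrightarrow> card {y. (v, y) \<in> I} = b"
    and same_line: "\<And>ps p q. berge_closed I ps \<Longrightarrow> distinct (map fst ps) \<Longrightarrow> length ps \<le> K \<Longrightarrow>
      p \<in> set ps \<Longrightarrow> q \<in> set ps \<Longrightarrow> snd p = snd q"

lemma biregular_incidence:
  fixes G :: "'a graph"
  assumes l: "l \<ge> 1" and G: "biregular m n a b G" and girth: "girth G > enat (4 * l + 2)"
  obtains A B :: "'a set" and I :: "('a \<times> 'a) set"
  where "high_girth_system A B I a b (2 * l + 1)" "card A = m" "card B = n" "card (edges G) = card I"
proof -
  have simple: "simple_graph G" using G by (simp add: biregular_def)
  from G obtain A B where AB: "verts G = A \<union> B" "A \<inter> B = {}"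
    and cards: "card A = m" "card B = n"
    and e: "\<forall>e\<in>edges G. \<exists>x\<in>A. \<exists>y\<in>B. e = {x, y}"
    and degA: "\<forall>v\<in>A. degree G v = b" and degB: "\<forall>y\<in>B. degree G y = a"
    unfolding biregular_def by (elim exE conjE) (rule that)
  define I where "I = {(v, y). v \<in> A \<and> y \<in> B \<and> {v, y} \<in> edges G}"
  have fin: "finite A" "finite B" using simple AB by (auto simp: simple_graph_def)
  have no_cycle: "\<not> has_copy (cycle_graph (2 * s)) G" if "2 \<le> s" "s \<le> 2 * l + 1" for s
  proof
    assume "has_copy (cycle_graph (2 * s)) G"
    then have "girth G \<le> enat (2 * s)"
      unfolding girth_def using that by (intro Inf_lower imageI) simp
    also have "\<dots> \<le> enat (4 * l + 2)" using that by simp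
    finally show False using girth by simp
  qed
  have I_sub: "I \<subseteq> A \<times> B" by (auto simp: I_def)
  have same: "snd p = snd q"
    if "berge_closed I ps" "distinct (map fst ps)" "length ps \<le> 2 * l + 1" "p \<in> set ps" "q \<in> set ps" for ps p q
    by (rule berge_closed_same_line[OF AB(2) I_sub _ _ no_cycle that]) (auto simp: I_def AB(1))
  have card_lines: "card (lines_through I y) = a" if y: "y \<in> B" for y
  proof -
    have "bij_betw (\<lambda>v. {v, y}) (lines_through I y) {e \<in> edges G. y \<in> e}"
    proof (rule bij_betw_imageI)
      show "inj_on (\<lambda>v. {v, y}) (lines_through I y)"
        by (auto simp: inj_on_def doubleton_eq_iff)
      show "(\<lambda>v. {v, y}) ` lines_through I y = {e \<in> edges G. y \<in> e}"
        using y AB(2) e by (fastforce simp: lines_through_def I_def)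
    qed
    then show ?thesis using bspec[OF degB y] by (simp add: degree_def bij_betw_same_card)
  qed
  have card_points: "card {y. (v, y) \<in> I} = b" if v: "v \<in> A" for v
  proof -
    have "bij_betw (\<lambda>y. {v, y}) {y. (v, y) \<in> I} {e \<in> edges G. v \<in> e}"
    proof (rule bij_betw_imageI)
      show "inj_on (\<lambda>y. {v, y}) {y. (v, y) \<in> I}"
        by (auto simp: inj_on_def doubleton_eq_iff)
      show "(\<lambda>y. {v, y}) ` {y. (v, y) \<in> I} = {e \<in> edges G. v \<in> e}"
        using v AB(2) e by (fastforce simp: I_def)
    qed
    then show ?thesis using bspec[OF degA v] by (simp add: degree_def bij_betw_same_card)
  qed
  have card_edges: "card (edges G) = card I"
  proof -
    have "bij_betw (\<lambda>(v, y). {v, y}) I (edges G)"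
    proof (rule bij_betw_imageI)
      show "inj_on (\<lambda>(v, y). {v, y}) I"
        using AB(2) by (auto simp: inj_on_def doubleton_eq_iff I_def)
      show "(\<lambda>(v, y). {v, y}) ` I = edges G"
        using e by (fastforce simp: I_def image_iff)
    qed
    then show ?thesis by (simp add: bij_betw_same_card)
  qed
  have "linear_system A B I a"
  proof
    fix x y assume xy: "x \<in> B" "y \<in> B" "x \<noteq> y"
    have "u = v" if "u \<in> lines_through I x \<inter> lines_through I y" "v \<in> lines_through I x \<inter> lines_through I y" for u v
    proof -
      have "berge_closed I [(x, u), (y, v)]"
        using that by (simp add: berge_closed_def lines_through_def)
      from same[OF this, of "(x, u)" "(y, v)"] show ?thesis using xy l by simp
    qed
    then show "card (lines_through I x \<inter> lines_through I y) \<le> 1"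
      by (metis card_le_Suc0_iff_eq One_nat_def card.infinite zero_le_one le_numeral_extra(3))
  qed (use fin I_sub card_lines in auto)
  then have "high_girth_system A B I a b (2 * l + 1)"
    by (intro high_girth_system.intro high_girth_system_axioms.intro card_points same)
  then show ?thesis using cards card_edges by (rule that)
qed

lemma (in linear_system) card_I_eq_points: "card I = card B * a"
proof -
  have "card I = card (SIGMA y:B. lines_through I y)"
    by (rule bij_betw_same_card[of prod.swap], rule bij_betw_imageI)
       (use I_sub in \<open>force simp: inj_on_def lines_through_def image_iff\<close>)+
  then show ?thesis using finB card_lines by simp
qed

lemma (in high_girth_system) card_I_eq_lines: "card I = card L * b"
proof -
  have fin: "finite {y. (v, y) \<in> I}" for v
    using I_sub finB by (auto intro: finite_subset[of _ B])
  have "I = (SIGMA v:L. {y. (v, y) \<in> I})" using I_sub by auto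
  then have "card I = card (SIGMA v:L. {y. (v, y) \<in> I})" by (rule arg_cong)
  with fin have "card I = (\<Sum>v\<in>L. card {y. (v, y) \<in> I})"
    using finL by simp
  then show ?thesis using card_points by simp
qed

text \<open>Distinct walks \<open>v, p, u, w\<close> without backtracking from a fixed line \<open>v\<close> end in distinct points \<open>w\<close>.\<close>

lemma (in high_girth_system) card_B_ge:
  assumes K: "K \<ge> 3" and L: "L \<noteq> {}"
  shows "b * (a - 1) * (b - 1) \<le> card B"
proof -
  obtain v where v: "v \<in> L" using L by auto
  let ?pts = "\<lambda>u. {y. (u, y) \<in> I}"
  have fin: "finite (?pts u)" for u using I_sub finB by (auto intro: finite_subset[of _ B])
  define X where "X = (SIGMA p:?pts v. SIGMA u:lines_through I p - {v}. ?pts u - {p})"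
  have "card X = (\<Sum>p\<in>?pts v. \<Sum>u\<in>lines_through I p - {v}. card (?pts u - {p}))"
    unfolding X_def using fin by simp
  also have "\<dots> = (\<Sum>p\<in>?pts v. \<Sum>u\<in>lines_through I p - {v}. b - 1)"
    using card_points fin I_sub by (intro sum.cong refl) (auto simp: lines_through_def card_Diff_singleton)
  also have "\<dots> = (\<Sum>p\<in>?pts v. (a - 1) * (b - 1))"
  proof (intro sum.cong refl)
    fix p assume p: "p \<in> ?pts v"
    then have "card (lines_through I p - {v}) = a - 1"
      using card_lines[of p] I_sub by (subst card_Diff_singleton) (auto simp: lines_through_def)
    then show "(\<Sum>u\<in>lines_through I p - {v}. b - 1) = (a - 1) * (b - 1)" by simp
  qed
  also have "\<dots> = b * (a - 1) * (b - 1)" using card_points[OF v] by simp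
  finally have cX: "card X = b * (a - 1) * (b - 1)" .
  have "inj_on (\<lambda>(p, u, w). w) X"
  proof -
    have "p = p' \<and> u = u'"
      if X: "(p, u, w) \<in> X" "(p', u', w) \<in> X" for p u w p' u'
    proof (cases "p = p'")
      case True
      have "berge_closed I [(p, u), (w, u')]"
        using X True by (auto simp: berge_closed_def lines_through_def X_def)
      from same_line[OF this, of "(p, u)" "(w, u')"] show ?thesis using X True K by (auto simp: X_def)
    next
      case False
      have "berge_closed I [(p, u), (w, u'), (p', v)]"
        using X by (auto simp: berge_closed_def lines_through_def X_def)
      from same_line[OF this, of "(p, u)" "(p', v)"] show ?thesis using X False K by (auto simp: X_def)
    qed
    then show ?thesis by (auto simp: inj_on_def)
  qed
  moreover have "(\<lambda>(p, u, w). w) ` X \<subseteq> B" using I_sub by (auto simp: X_def)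
  ultimately have "card X \<le> card B" using finB by (rule card_inj_on_le)
  then show ?thesis using cX by simp
qed

lemma biregular_counts:
  fixes G :: "'a graph"
  assumes l: "l \<ge> 1" and G: "biregular m n a b G" and girth: "girth G > enat (4 * l + 2)" and n: "n > 0" "a > 0"
  shows "card (edges G) = n * a" "m * b = n * a" "b * (a - 1) * (b - 1) \<le> n"
proof -
  obtain A B :: "'a set" and I where
    S: "high_girth_system A B I a b (2 * l + 1)" "card A = m" "card B = n" "card (edges G) = card I"
    by (rule biregular_incidence[OF l G girth])
  interpret high_girth_system A B I a b "2 * l + 1" by (fact S(1))
  show 1: "card (edges G) = n * a" using card_I_eq_points S by simp
  show 2: "m * b = n * a" using card_I_eq_lines 1 S by simp
  have "A \<noteq> {}" using 2 S(2) n by auto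
  then show "b * (a - 1) * (b - 1) \<le> n"
    using card_B_ge l S(3) by simp
qed

theorem ramsey_number_odd_cycle_gt:
  fixes G :: "'a graph"
  assumes l: "l \<ge> 1" and G: "biregular m n a b G" and girth: "girth G > enat (4 * l + 2)"
    and a: "a > 0" and m: "m > 0" and na: "real n ^ 2 \<le> 2 ^ a" and \<delta>: "real a ^ 2 \<le> 64 * real m"
    and t: "real t \<le> 32 * real m / real a" and t0: "t > 0"
    and k: "real n * (1 - real a ^ 2 / (64 * real m)) ^ k \<le> 32 * real m / real a"
    and kt: "real (n + 1) ^ k \<le> 2 ^ t"
    and N: "18 * (32 * real m / real a) * real N < real t * real n"
    and NB: "N \<le> n" and tB: "t \<le> n"
  shows "ramsey_number (cycle_graph (2 * l + 1)) t > N"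
proof -
  obtain A B :: "'a set" and I where
    S: "high_girth_system A B I a b (2 * l + 1)" "card A = m" "card B = n" "card (edges G) = card I"
    by (rule biregular_incidence[OF l G girth])
  interpret high_girth_system A B I a b "2 * l + 1" by (fact S(1))
  obtain \<chi> W where W: "W \<subseteq> B" "card W = N"
    and indep: "\<And>S. S \<subseteq> W \<Longrightarrow> card S = t \<Longrightarrow> \<exists>x\<in>S. \<exists>y\<in>S. colour_adj I \<chi> x y"
    using exists_colouring_and_sample[OF a, unfolded S(2,3), OF na \<delta> m t t0 k kt N NB tB]
    by blast
  let ?H = "colour_graph I \<chi> W"
  have "finite W" using W finB finite_subset by blast
  then have "simple_graph ?H" by (rule simple_colour_graph)
  moreover have "\<not> has_copy (cycle_graph (2 * l + 1)) ?H"
    using l by (intro colour_graph_odd_cycle_free same_line) auto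
  moreover have "\<not> has_indep_set ?H t"
  proof
    assume "has_indep_set ?H t"
    then obtain S where S: "S \<subseteq> W" "card S = t" "indep S (edges ?H)"
      by (auto simp: has_indep_set_def colour_graph_def)
    then obtain x y where "x \<in> S" "y \<in> S" "colour_adj I \<chi> x y" using indep by blast
    moreover from this have "x \<noteq> y" by (auto simp: colour_adj_irrefl)
    ultimately show False using S by (auto simp: indep_def edge_colour_graph_iff)
  qed
  ultimately have "ramsey_number (cycle_graph (2 * l + 1)) t > card (verts ?H)"
    using l by (intro ramsey_number_gt simple_cycle_graph) auto
  then show ?thesis using W by (simp add: colour_graph_def)
qed

section \<open>Choice of the parameters\<close>

text \<open>For \<open>\<Lambda> = ln (n + 1)\<close> the number \<open>k\<close> of shrinking steps is about \<open>64 (m / a\<^sup>2) \<Lambda>\<close>, which brings the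
weight from \<open>n\<close> down to 1, and the order \<open>t\<close> about \<open>2 k \<Lambda>\<close>, which makes \<open>(n + 1)^k \<le> 2^t\<close>. The
sample size \<open>N\<close> is the largest integer with \<open>18 D N < t n\<close>, where \<open>D = 32 m / a\<close>; by \<open>m b = n a\<close> it is
about \<open>t b / 576\<close>. The inequality \<open>m / a\<^sup>2 \<ge> b / 4\<close>, a consequence of the girth, absorbs all rounding
errors and gives \<open>t \<ge> 32 b\<close>.\<close>

lemma exists_good_order:
  fixes G :: "'a graph" and m n a b l :: nat
  defines "\<Lambda> \<equiv> ln (real n + 1)"
  assumes l: "l \<ge> 1" and G: "biregular m n a b G" and girth: "girth G > enat (4 * l + 2)"
    and n: "n \<ge> 2" and a32: "a \<ge> 32" and a_log: "real a \<ge> 5 * \<Lambda> ^ 2"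
  shows "\<exists>t. 32 * b \<le> t \<and> real t \<le> 134 * (real m / real a ^ 2) * \<Lambda> ^ 2 \<and>
    real t * real b / 576 \<le> real (ramsey_number (cycle_graph (2 * l + 1)) t)"
proof -
  define \<mu> where "\<mu> = real m / real a ^ 2"
  define D where "D = 32 * real m / real a"
  have ab: "a \<le> b" using G by (simp add: biregular_def)
  have mb: "real m * real b = real n * real a" 
    and nb: "b * (a - 1) * (b - 1) \<le> n"
    using biregular_counts[OF l G girth] n a32 by (auto simp flip: of_nat_mult)
  have m0: "m > 0" using mb n a32 by (cases "m = 0") auto
  have "real b * (real a / 2) * (real b / 2) \<le> real b * real (a - 1) * real (b - 1)"
    using a32 ab by (intro mult_mono) (auto simp: of_nat_diff)
  also have "\<dots> \<le> real n" using nb by (simp flip: of_nat_mult)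
  finally have "(real b * (real a / 2) * (real b / 2)) * real a \<le> real n * real a"
    by (rule mult_right_mono) simp
  then have "real b * (real a ^ 2 * real b / 4) \<le> real b * real m"
    using mb by (simp add: power2_eq_square mult_ac)
  then have m_ge: "real a ^ 2 * real b / 4 \<le> real m" using a32 ab by simp
  have \<mu>b: "\<mu> \<ge> real b / 4" using m_ge a32 by (simp add: \<mu>_def field_simps)
  then have \<mu>8: "\<mu> \<ge> 8" using a32 ab by simp
  have \<Lambda>1: "\<Lambda> \<ge> 1"
  proof -
    have "exp 1 \<le> real n + 1" using exp_le n by linarith
    then have "ln (exp 1) \<le> \<Lambda>" unfolding \<Lambda>_def by (subst ln_le_cancel_iff) auto
    then show ?thesis by simp
  qed
  have L2: "\<Lambda> \<le> \<Lambda> ^ 2" using \<Lambda>1 by (simp add: power2_eq_square)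
  define k where "k = nat \<lceil>64 * \<mu> * \<Lambda>\<rceil>"
  define t where "t = nat \<lceil>2 * real k * \<Lambda>\<rceil>"
  have \<mu>L: "\<mu> * \<Lambda> \<ge> 8" using mult_mono[of 8 \<mu> 1 \<Lambda>] \<mu>8 \<Lambda>1 by simp
  have k: "64 * \<mu> * \<Lambda> \<le> real k" "real k \<le> 66 * \<mu> * \<Lambda>"
    unfolding k_def using \<mu>L by linarith+
  have t: "2 * real k * \<Lambda> \<le> real t" "real t \<le> 2 * real k * \<Lambda> + 1"
    unfolding t_def using \<Lambda>1 mult_nonneg_nonneg[of "2 * real k" \<Lambda>] by linarith+
  have k1: "real k \<ge> 1" using k(1) \<mu>L by linarith
  have "2 * (64 * \<mu> * \<Lambda>) * \<Lambda> \<le> 2 * real k * \<Lambda>"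
    using k(1) \<Lambda>1 by (intro mult_right_mono mult_left_mono) auto
  then have t_low: "128 * (\<mu> * \<Lambda> ^ 2) \<le> real t" using t(1) by (simp add: power2_eq_square mult_ac)
  have \<mu>LL: "\<mu> * \<Lambda> ^ 2 \<ge> \<mu>" using L2 \<Lambda>1 \<mu>8 by (simp add: mult_le_cancel_left1)
  have t_32b: "32 * real b \<le> real t" using t_low \<mu>LL \<mu>b by linarith
  have "2 * real k * \<Lambda> \<le> 2 * (66 * \<mu> * \<Lambda>) * \<Lambda>"
    using k(2) \<Lambda>1 by (intro mult_right_mono mult_left_mono) auto
  then have "real t \<le> 132 * (\<mu> * \<Lambda> ^ 2) + 1" using t(2) by (simp add: power2_eq_square mult_ac)
  then have t_up: "real t \<le> 134 * (\<mu> * \<Lambda> ^ 2)" using \<mu>LL \<mu>8 by linarith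
  have D: "D = 32 * real a * \<mu>" using a32 by (simp add: D_def \<mu>_def power2_eq_square)
  have t_D: "real t \<le> D"
  proof -
    have "134 * \<Lambda> ^ 2 \<le> 32 * real a" using a_log by linarith
    then have "134 * \<Lambda> ^ 2 * \<mu> \<le> 32 * real a * \<mu>" using \<mu>8 by (intro mult_right_mono) auto
    then show ?thesis using t_up D by (simp add: mult_ac)
  qed
  have D0: "D > 0" using m0 a32 by (simp add: D_def)
  have Db: "D * real b = 32 * real n"
  proof -
    have "real a * (D * real b) = real a * (32 * real n)"
      using mb a32 by (simp add: D_def mult_ac)
    then show ?thesis using a32 by simp
  qed
  have D_n: "D \<le> real n"
  proof -
    have "D * 32 \<le> D * real b" using D0 a32 ab by (intro mult_left_mono) auto
    then show ?thesis using Db by simp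
  qed
  have n_exp: "real (n + 1) = exp \<Lambda>" by (simp add: \<Lambda>_def)
  have ln2: "ln 2 \<ge> (1/2 :: real)" using ln_le_minus_one[of "1/2 :: real"] by (simp add: ln_div)
  have two: "exp (c / 2) \<le> 2 powr c" if "c \<ge> 0" for c :: real
    using mult_left_mono[OF ln2 that] by (simp add: powr_def)
  have c_na: "real n ^ 2 \<le> 2 ^ a"
  proof -
    have "real n ^ 2 \<le> real (n + 1) ^ 2" by (intro power_mono) auto
    also have "\<dots> = exp (2 * \<Lambda>)" unfolding n_exp by (simp add: power2_eq_square flip: exp_add)
    also have "\<dots> \<le> exp (real a / 2)" using a_log L2 \<Lambda>1 by simp
    also have "\<dots> \<le> 2 powr real a" by (rule two) simp
    also have "\<dots> = 2 ^ a" by (simp add: powr_realpow)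
    finally show ?thesis .
  qed
  have c_\<delta>: "real a ^ 2 \<le> 64 * real m"
  proof -
    have "real a ^ 2 * 1 \<le> real a ^ 2 * real b" using a32 ab by (intro mult_left_mono) auto
    then show ?thesis using m_ge by simp
  qed
  have c_k: "real n * (1 - real a ^ 2 / (64 * real m)) ^ k \<le> D"
  proof -
    let ?\<delta> = "real a ^ 2 / (64 * real m)"
    have \<delta>: "?\<delta> = 1 / (64 * \<mu>)" by (simp add: \<mu>_def)
    have "(1 - ?\<delta>) ^ k \<le> exp (- ?\<delta>) ^ k"
      using c_\<delta> m0 exp_ge_add_one_self[of "- ?\<delta>"] by (intro power_mono) (auto simp: field_simps)
    also have "\<dots> = exp (- (real k / (64 * \<mu>)))" by (simp add: \<delta> flip: exp_of_nat_mult)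
    also have "\<dots> \<le> exp (- \<Lambda>)"
      using k(1) \<mu>8 by (simp add: pos_le_divide_eq mult_ac)
    finally have "real n * (1 - ?\<delta>) ^ k \<le> real (n + 1) * exp (- \<Lambda>)"
      using c_\<delta> m0 by (intro mult_mono) auto
    also have "\<dots> = 1" unfolding n_exp by (simp flip: exp_add)
    also have "1 \<le> D" using D mult_mono[of 1 "32 * real a" 1 \<mu>] a32 \<mu>8 by simp
    finally show ?thesis .
  qed
  have c_kt: "real (n + 1) ^ k \<le> 2 ^ t"
  proof -
    have "real (n + 1) ^ k = exp (real k * \<Lambda>)" unfolding n_exp by (simp flip: exp_of_nat_mult)
    also have "\<dots> \<le> exp (real t / 2)" using t(1) by simp
    also have "\<dots> \<le> 2 powr real t" by (rule two) simp
    also have "\<dots> = 2 ^ t" by (simp add: powr_realpow)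
    finally show ?thesis .
  qed
  have t0: "t > 0" using t_32b a32 ab by (cases "t = 0") auto
  define z where "z = real t * real n / (18 * D)"
  define N where "N = nat \<lceil>z\<rceil> - 1"
  have z0: "z > 0" unfolding z_def using t0 n D0 by simp
  have N: "real N < z" "z \<le> real N + 1" unfolding N_def using z0 by linarith+
  have "z \<le> real n"
  proof -
    have "real t * real n \<le> D * real n" using t_D by (intro mult_right_mono) auto
    also have "\<dots> \<le> 18 * D * real n" using D0 by simp
    finally show ?thesis unfolding z_def using D0 by (simp add: divide_le_eq mult_ac)
  qed
  then have NB: "N \<le> n" using N by linarith
  have "18 * D * real N < real t * real n"
    using N(1) D0 unfolding z_def by (simp add: less_divide_eq mult_ac)
  then have "N < ramsey_number (cycle_graph (2 * l + 1)) t"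
    using t_D D_n c_k a32
    by (intro ramsey_number_odd_cycle_gt[OF l G girth _ m0 c_na c_\<delta> _ t0 _ c_kt _ NB])
       (auto simp: D_def)
  moreover have "z = real t * real b / 576"
  proof -
    have "z = real t * (32 * real n) / (576 * D)" by (simp add: z_def)
    also have "\<dots> = real t * real b / 576" unfolding Db[symmetric] using D0 by simp
    finally show ?thesis .
  qed
  ultimately have "real t * real b / 576 \<le> real (ramsey_number (cycle_graph (2 * l + 1)) t)"
    using N(2) by linarith
  moreover have "32 * b \<le> t" using t_32b by linarith
  moreover have "134 * \<mu> * \<Lambda> ^ 2 = 134 * (\<mu> * \<Lambda> ^ 2)" by simp
  ultimately show ?thesis using t_up unfolding \<mu>_def[symmetric] by (intro exI[of _ t]) simp
qed

text \<open>The edgeless graph on \<open>t - 1\<close> vertices.\<close>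

lemma ramsey_number_ge_order:
  assumes F: "simple_graph F" "edges F \<noteq> {}" and t: "t > 0"
  shows "ramsey_number F t \<ge> t"
proof -
  define H :: "nat graph" where "H = \<lparr>verts = {..<t - 1}, edges = {}\<rparr>"
  have "simple_graph H" by (simp add: simple_graph_def H_def)
  moreover have "\<not> has_copy F H"
    using F(2) by (auto simp: has_copy_def subgraph_def isomorphic_def H_def)
  moreover have "\<not> has_indep_set H t"
  proof
    assume "has_indep_set H t"
    then obtain S where "S \<subseteq> {..<t - 1}" "card S = t" by (auto simp: has_indep_set_def H_def)
    then show False using card_mono[of "{..<t - 1}" S] t by simp
  qed
  ultimately have "ramsey_number F t > card (verts H)" by (rule ramsey_number_gt[OF F(1)])
  then show ?thesis by (simp add: H_def)
qed

section \<open>The exponents\<close>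

text \<open>The two exponents of the theorem are \<open>1 + x\<close> and \<open>2 x + 1\<close> for the same \<open>x\<close>, and \<open>x\<close> has the sign
of \<open>2 \<beta> - 1\<close>.\<close>

lemma exponent_arithmetic:
  fixes \<alpha> \<beta> :: real
  defines "d \<equiv> \<alpha> - 3 * \<beta> - \<alpha> * \<beta> + 2"
  defines "x \<equiv> \<alpha> * (2 * \<beta> - 1) / d"
  assumes \<alpha>: "1 \<le> \<alpha>" and \<beta>: "0 < \<beta>" "\<beta> \<le> 2 / 3"
  shows "\<alpha> / 3 \<le> d" "d > 0" "-1 \<le> x" "x \<le> 1"
    "(\<alpha> * \<beta> - 3 * \<beta> + 2) / d = 1 + x"
    "(3 * \<alpha> * \<beta> - \<alpha> - 3 * \<beta> + 2) / d = 2 * x + 1"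
proof -
  have "\<alpha> * \<beta> \<le> \<alpha> * (2 / 3)" using \<alpha> \<beta> by (intro mult_left_mono) auto
  then show d3: "\<alpha> / 3 \<le> d" using \<beta> unfolding d_def by linarith
  then show d0: "d > 0" using \<alpha> by linarith
  have "(\<alpha> + 1) * (3 * \<beta> - 2) \<le> 0" using \<alpha> \<beta> by (intro mult_nonneg_nonpos) auto
  then show "x \<le> 1" unfolding x_def using d0 by (simp add: divide_le_eq d_def algebra_simps)
  have "0 \<le> \<alpha> * \<beta>" using \<alpha> \<beta> by simp
  then show "-1 \<le> x" unfolding x_def using d0 \<beta> by (simp add: le_divide_eq d_def algebra_simps)
  have dn: "d \<noteq> 0" using d0 by simp
  have "\<alpha> * \<beta> - 3 * \<beta> + 2 = d + \<alpha> * (2 * \<beta> - 1)" by (simp add: d_def algebra_simps)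
  then show "(\<alpha> * \<beta> - 3 * \<beta> + 2) / d = 1 + x"
    using dn by (simp add: add_divide_distrib x_def)
  have "3 * \<alpha> * \<beta> - \<alpha> - 3 * \<beta> + 2 = 2 * (\<alpha> * (2 * \<beta> - 1)) + d" by (simp add: d_def algebra_simps)
  then show "(3 * \<alpha> * \<beta> - \<alpha> - 3 * \<beta> + 2) / d = 2 * x + 1"
    using dn by (simp add: add_divide_distrib x_def)
qed

lemma powr_log_regroup:
  fixes t u x :: real
  assumes "t > 0" "u > 0"
  shows "t powr (1 + x) * u powr (- (2 * x + 1)) = t * (t / u ^ 2) powr x / u"
proof -
  have "u powr (- (2 * x + 1)) = u powr (- 2 * x) * u powr (- 1)"
    by (simp only: powr_add[symmetric]) simp
  also have "u powr (- 2 * x) = (u ^ 2) powr (- x)"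
  proof -
    have "u ^ 2 = u powr 2" using assms by simp
    then show ?thesis by (simp only: powr_powr) simp
  qed
  finally show ?thesis using assms
    by (simp add: powr_add powr_divide powr_minus_divide)
qed

text \<open>This is where the number of edges enters: with \<open>\<mu> = m / a\<^sup>2\<close> the edge bound reads
\<open>c \<mu>^(2 \<beta> - 1) \<le> a^d\<close>, and raising it to the power \<open>\<alpha> / d \<le> 3\<close> bounds \<open>\<mu>^x\<close> by a constant
multiple of \<open>b = a^\<alpha>\<close>.\<close>

lemma degree_ratio_bound:
  fixes a m n b :: nat and c \<alpha> \<beta> :: real
  defines "d \<equiv> \<alpha> - 3 * \<beta> - \<alpha> * \<beta> + 2"
  assumes a: "a \<ge> 2" and m: "m > 0" and mb: "real m * real b = real n * real a"
    and b: "real b = real a powr \<alpha>" and \<alpha>: "1 \<le> \<alpha>" and \<beta>: "1 / 2 \<le> \<beta>" "\<beta> \<le> 2 / 3"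
    and c: "0 < c" "c \<le> 1" and e: "c * (real m * real n) powr \<beta> \<le> real n * real a"
  shows "c ^ 3 * (real m / real a ^ 2) powr (\<alpha> * (2 * \<beta> - 1) / d) \<le> real b"
proof -
  define \<mu> where "\<mu> = real m / real a ^ 2"
  let ?A = "real a"
  have A: "?A > 0" using a by simp
  have \<mu>0: "\<mu> > 0" using m A by (simp add: \<mu>_def)
  have d: "\<alpha> / 3 \<le> d" "d > 0" using exponent_arithmetic[of \<alpha> \<beta>] \<alpha> \<beta> unfolding d_def by auto
  have m_eq: "real m = \<mu> * ?A powr 2" using A by (simp add: \<mu>_def powr_numeral)
  have na: "real n * ?A = \<mu> * ?A powr (2 + \<alpha>)"
    using mb by (simp add: b m_eq powr_add mult_ac)
  have n_eq: "real n = \<mu> * ?A powr (1 + \<alpha>)"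
  proof -
    have "real n * ?A = \<mu> * ?A powr (1 + \<alpha>) * ?A"
      using A unfolding na by (simp add: powr_add powr_numeral power2_eq_square)
    then show ?thesis using A by simp
  qed
  have "real m * real n = \<mu> powr 2 * ?A powr (3 + \<alpha>)"
    unfolding m_eq n_eq using A \<mu>0 by (simp add: powr_add powr_numeral power2_eq_square power3_eq_cube)
  then have "(real m * real n) powr \<beta> = \<mu> powr (2 * \<beta>) * ?A powr ((3 + \<alpha>) * \<beta>)"
    using A \<mu>0 by (simp add: powr_mult powr_powr del: powr_numeral)
  also have "\<dots> = \<mu> * \<mu> powr (2 * \<beta> - 1) * (?A powr (2 + \<alpha>) * ?A powr (- d))"
  proof -
    have "?A powr ((3 + \<alpha>) * \<beta>) = ?A powr (2 + \<alpha>) * ?A powr (- d)"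
      by (simp only: powr_add[symmetric]) (simp add: d_def algebra_simps)
    moreover have "\<mu> powr (2 * \<beta>) = \<mu> * \<mu> powr (2 * \<beta> - 1)"
      using \<mu>0 by (simp add: powr_diff)
    ultimately show ?thesis by simp
  qed
  finally have "c * (\<mu> * \<mu> powr (2 * \<beta> - 1) * (?A powr (2 + \<alpha>) * ?A powr (- d))) \<le> \<mu> * ?A powr (2 + \<alpha>)"
    using e na by simp
  then have "(\<mu> * ?A powr (2 + \<alpha>)) * (c * \<mu> powr (2 * \<beta> - 1) * ?A powr (- d)) \<le> (\<mu> * ?A powr (2 + \<alpha>)) * 1"
    by (simp add: mult_ac)
  then have "c * \<mu> powr (2 * \<beta> - 1) * ?A powr (- d) \<le> 1"
    using \<mu>0 A by (subst (asm) mult_le_cancel_left_pos) auto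
  then have "c * \<mu> powr (2 * \<beta> - 1) \<le> ?A powr d"
    using A by (simp add: powr_minus_divide divide_le_eq)
  then have "(c * \<mu> powr (2 * \<beta> - 1)) powr (\<alpha> / d) \<le> (?A powr d) powr (\<alpha> / d)"
    using c \<alpha> d by (intro powr_mono2) auto
  also have "\<dots> = real b" using d by (simp add: powr_powr b)
  also have "(c * \<mu> powr (2 * \<beta> - 1)) powr (\<alpha> / d) = c powr (\<alpha> / d) * \<mu> powr (\<alpha> * (2 * \<beta> - 1) / d)"
    using c by (simp add: powr_mult powr_powr mult.commute)
  finally have "c powr (\<alpha> / d) * \<mu> powr (\<alpha> * (2 * \<beta> - 1) / d) \<le> real b" .
  moreover have "c ^ 3 \<le> c powr (\<alpha> / d)"
  proof -
    have "\<alpha> / d \<le> 3" using d by (simp add: divide_le_eq)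
    then have "c powr 3 \<le> c powr (\<alpha> / d)" using c by (intro powr_mono') auto
    then show ?thesis using c by (simp add: powr_numeral)
  qed
  ultimately show ?thesis unfolding \<mu>_def[symmetric]
    by (meson mult_right_mono order_trans powr_ge_zero)
qed

text \<open>For \<open>\<beta> > 1/2\<close> the edge bound also makes \<open>a\<close> at least a constant times a fixed power of \<open>n\<close>, so that \<open>a\<close> dominates all powers of
\<open>ln n\<close>.\<close>

lemma degree_ge_power:
  fixes a m n b :: nat and c \<alpha> \<alpha>\<^sub>0 \<beta> :: real
  assumes a: "a \<ge> 2" and n: "n > 0" and mb: "real m * real b = real n * real a"
    and b: "real b = real a powr \<alpha>" and \<alpha>: "1 \<le> \<alpha>" "\<alpha> \<le> \<alpha>\<^sub>0" and \<beta>: "1 / 2 \<le> \<beta>" "\<beta> \<le> 1"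
    and c: "0 < c" and e: "c * (real m * real n) powr \<beta> \<le> real n * real a"
  shows "c * real n powr (2 * \<beta> - 1) \<le> real a powr \<alpha>\<^sub>0"
proof -
  let ?A = "real a"
  have A: "?A > 0" using a by simp
  have b0: "real b > 0" using A by (simp add: b)
  have "real m = real n * ?A powr (1 - \<alpha>)"
    using mb b0 A unfolding b by (simp add: powr_diff field_simps)
  then have "(real m * real n) powr \<beta> = (real n powr 2 * ?A powr (1 - \<alpha>)) powr \<beta>"
    using n by (simp add: powr_numeral power2_eq_square mult_ac)
  also have "\<dots> = real n powr (2 * \<beta>) * ?A powr ((1 - \<alpha>) * \<beta>)"
    by (simp add: powr_mult powr_powr del: powr_numeral)
  also have "\<dots> = real n * (real n powr (2 * \<beta> - 1) * ?A powr ((1 - \<alpha>) * \<beta>))"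
    using n by (simp add: powr_diff)
  finally have "real n * (c * real n powr (2 * \<beta> - 1) * ?A powr ((1 - \<alpha>) * \<beta>)) \<le> real n * ?A"
    using e by (simp add: mult_ac)
  then have "c * real n powr (2 * \<beta> - 1) * ?A powr ((1 - \<alpha>) * \<beta>) \<le> ?A"
    using n by (subst (asm) mult_le_cancel_left_pos) auto
  then have "c * real n powr (2 * \<beta> - 1) * ?A powr ((1 - \<alpha>) * \<beta>) * ?A powr ((\<alpha> - 1) * \<beta>) \<le> ?A * ?A powr ((\<alpha> - 1) * \<beta>)"
    by (rule mult_right_mono) simp
  moreover have "?A powr ((1 - \<alpha>) * \<beta>) * ?A powr ((\<alpha> - 1) * \<beta>) = 1"
    using A by (simp flip: powr_add) (simp add: algebra_simps)
  ultimately have "c * real n powr (2 * \<beta> - 1) \<le> ?A * ?A powr ((\<alpha> - 1) * \<beta>)"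
    by (simp add: mult.assoc)
  also have "\<dots> = ?A powr (1 + (\<alpha> - 1) * \<beta>)" using A by (simp add: powr_add)
  also have "\<dots> \<le> ?A powr \<alpha>\<^sub>0"
  proof (intro powr_mono)
    have "(\<alpha> - 1) * \<beta> \<le> (\<alpha> - 1) * 1" using \<alpha> \<beta> by (intro mult_left_mono) auto
    then show "1 + (\<alpha> - 1) * \<beta> \<le> \<alpha>\<^sub>0" using \<alpha>(2) by (simp add: algebra_simps)
  qed (use a in auto)
  finally show ?thesis .
qed

lemma eventually_powr_ge:
  fixes s C :: real
  assumes "s > 0"
  shows "eventually (\<lambda>x. x powr s \<ge> C) at_top"
proof -
  let ?C = "max C 1"
  have "x powr s \<ge> C" if "x \<ge> ?C powr (1 / s)" for x :: real
  proof -
    have "(?C powr (1 / s)) powr s \<le> x powr s" using assms that by (intro powr_mono2) auto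
    then show ?thesis using assms by (simp add: powr_powr)
  qed
  then show ?thesis unfolding eventually_at_top_linorder by blast
qed

section \<open>The lower bound\<close>

text \<open>The bound for one graph, in the case \<open>\<beta> > 1/2\<close>, as soon as \<open>n\<close> exceeds a constant depending only on
\<open>\<beta>\<close>, \<open>\<alpha>\<^sub>0\<close> and \<open>c\<close>. The order \<open>t\<close> satisfies \<open>t \<le> 134 (m / a\<^sup>2) (ln (n + 1))\<^sup>2\<close> and, being at least
\<open>a \<ge> (n + 1)^\<epsilon>\<close>, also \<open>log t \<ge> \<epsilon> ln (n + 1)\<close>. Hence \<open>t / (log t)\<^sup>2\<close> is at most a constant times
\<open>m / a\<^sup>2\<close>, and its power with exponent \<open>x\<close> at most a constant times \<open>b\<close>.\<close>

lemma ramsey_number_odd_cycle_ge: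
  fixes G :: "'a graph" and m n a b l :: nat and \<alpha> \<alpha>\<^sub>0 \<beta> c :: real
  defines "s \<equiv> 2 * \<beta> - 1" and "y \<equiv> real n + 1"
  defines "\<epsilon> \<equiv> s / (2 * \<alpha>\<^sub>0)"
  defines "d \<equiv> \<alpha> - 3 * \<beta> - \<alpha> * \<beta> + 2"
  assumes l: "l \<ge> 1" and G: "biregular m n a b G" and girth: "girth G > enat (4 * l + 2)"
    and a: "a \<ge> 2" and b: "real b = real a powr \<alpha>" and \<alpha>: "1 \<le> \<alpha>" "\<alpha> \<le> \<alpha>\<^sub>0"
    and \<beta>: "1 / 2 < \<beta>" "\<beta> \<le> 2 / 3" and c: "0 < c" "c \<le> 1"
    and e: "c * (real m * real n) powr \<beta> \<le> real (card (edges G))"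
    and y: "y \<ge> 3" "y powr (s / 2) \<ge> 2 powr s / c" "y powr (\<epsilon> / 2) \<ge> 80 / \<epsilon> ^ 2" "y powr \<epsilon> \<ge> 32"
  shows "\<exists>t\<ge>2. y powr \<epsilon> \<le> real t \<and>
    c ^ 3 / (576 * max 1 (134 / \<epsilon> ^ 2)) * real t powr ((\<alpha> * \<beta> - 3 * \<beta> + 2) / d)
      * log 2 (real t) powr (- ((3 * \<alpha> * \<beta> - \<alpha> - 3 * \<beta> + 2) / d))
    \<le> real (ramsey_number (cycle_graph (2 * l + 1)) t)"
proof -
  have s: "s > 0" and \<alpha>0: "\<alpha>\<^sub>0 > 0" using \<alpha> \<beta> by (auto simp: s_def)
  then have \<epsilon>: "\<epsilon> > 0" by (simp add: \<epsilon>_def)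
  have n: "n \<ge> 2" using y(1) by (simp add: y_def)
  have counts: "card (edges G) = n * a" "m * b = n * a"
    using biregular_counts[OF l G girth] n a by auto
  have mb: "real m * real b = real n * real a" using counts(2) by (simp flip: of_nat_mult)
  have m0: "m > 0" using mb n a by (cases "m = 0") auto
  have e': "c * (real m * real n) powr \<beta> \<le> real n * real a" using e counts(1) by simp
  have a_ge: "y powr \<epsilon> \<le> real a"
  proof -
    have "y powr (s / 2) * y powr (s / 2) = y powr s" by (simp flip: powr_add)
    moreover have "y powr (s / 2) * (2 powr s / c) \<le> y powr (s / 2) * y powr (s / 2)"
      by (intro mult_left_mono y(2)) simp
    ultimately have "y powr (s / 2) \<le> c * (y / 2) powr s"
      using c y(1) by (simp add: powr_divide field_simps)
    also have "\<dots> \<le> c * real n powr s"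
      using c y(1) s n by (intro mult_left_mono powr_mono2) (auto simp: y_def)
    also have "\<dots> \<le> real a powr \<alpha>\<^sub>0"
      using degree_ge_power[OF a _ mb b \<alpha> _ _ c(1) e'] \<beta> n by (simp add: s_def)
    finally have "(y powr (s / 2)) powr (1 / \<alpha>\<^sub>0) \<le> (real a powr \<alpha>\<^sub>0) powr (1 / \<alpha>\<^sub>0)"
      using \<alpha>0 by (intro powr_mono2) auto
    then show ?thesis using \<alpha>0 a by (simp add: powr_powr \<epsilon>_def)
  qed
  define \<Lambda> where "\<Lambda> = ln y"
  have \<Lambda>0: "\<Lambda> > 0" using y(1) by (simp add: \<Lambda>_def)
  have a_log: "5 * \<Lambda> ^ 2 \<le> real a"
  proof -
    have "\<Lambda> \<le> y powr (\<epsilon> / 4) / (\<epsilon> / 4)"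
      unfolding \<Lambda>_def using y(1) \<epsilon> by (intro ln_powr_bound) auto
    then have "\<Lambda> ^ 2 \<le> (y powr (\<epsilon> / 4) / (\<epsilon> / 4)) ^ 2" using \<Lambda>0 by (intro power_mono) auto
    also have "\<dots> = 16 / \<epsilon> ^ 2 * (y powr (\<epsilon> / 4)) ^ 2" by (simp add: power_divide)
    also have "(y powr (\<epsilon> / 4)) ^ 2 = y powr (\<epsilon> / 2)"
      by (simp add: power2_eq_square flip: powr_add)
    finally have "5 * \<Lambda> ^ 2 \<le> 80 / \<epsilon> ^ 2 * y powr (\<epsilon> / 2)" by simp
    also have "\<dots> \<le> y powr (\<epsilon> / 2) * y powr (\<epsilon> / 2)" by (intro mult_right_mono y(3)) simp
    also have "\<dots> = y powr \<epsilon>" by (simp flip: powr_add)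
    finally show ?thesis using a_ge by linarith
  qed
  have a32: "a \<ge> 32" using a_ge y(4) by linarith
  have ab: "a \<le> b" using G by (simp add: biregular_def)
  define \<mu> where "\<mu> = real m / real a ^ 2"
  obtain t where t: "32 * b \<le> t" "real t \<le> 134 * \<mu> * \<Lambda> ^ 2"
    and r: "real t * real b / 576 \<le> real (ramsey_number (cycle_graph (2 * l + 1)) t)"
    using exists_good_order[OF l G girth n a32] a_log unfolding \<Lambda>_def y_def \<mu>_def by blast
  have ta: "real a \<le> real t" using t(1) ab by linarith
  have t2: "t \<ge> 2" using ta a32 by linarith
  define u where "u = log 2 (real t)"
  have u1: "u \<ge> 1" using t2 by (simp add: u_def le_log_iff)
  have u_ge: "\<epsilon> * \<Lambda> \<le> u"
  proof -
    have "ln (y powr \<epsilon>) \<le> ln (real t)"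
      using a_ge ta y(1) t2 by (subst ln_le_cancel_iff) auto
    then have "\<epsilon> * \<Lambda> \<le> ln (real t)" using y(1) by (simp add: \<Lambda>_def)
    also have "\<dots> \<le> ln (real t) / ln 2"
      using t2 ln_2_less_1 by (simp add: le_divide_eq mult_left_le)
    finally show ?thesis by (simp add: u_def log_def)
  qed
  define x where "x = \<alpha> * (2 * \<beta> - 1) / d"
  note ex = exponent_arithmetic[OF \<alpha>(1) _ \<beta>(2), folded d_def, folded x_def]
  have d0: "d > 0" and x1: "x \<le> 1" using ex \<beta> by auto
  have x0: "x \<ge> 0" using \<alpha> \<beta> d0 by (simp add: x_def)
  define M where "M = max 1 (134 / \<epsilon> ^ 2)"
  have M1: "M \<ge> 1" by (simp add: M_def)
  have \<mu>0: "\<mu> > 0" using m0 a by (simp add: \<mu>_def)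
  have "real t / u ^ 2 \<le> M * \<mu>"
  proof -
    have "real t / u ^ 2 \<le> 134 * \<mu> * \<Lambda> ^ 2 / (\<epsilon> * \<Lambda>) ^ 2"
      using u_ge \<epsilon> \<Lambda>0 t(2) u1 \<mu>0 by (intro frac_le power_mono) auto
    also have "\<dots> = 134 / \<epsilon> ^ 2 * \<mu>" using \<Lambda>0 by (simp add: power_mult_distrib)
    also have "\<dots> \<le> M * \<mu>" using \<mu>0 by (intro mult_right_mono) (auto simp: M_def)
    finally show ?thesis .
  qed
  then have "(real t / u ^ 2) powr x \<le> (M * \<mu>) powr x" using x0 by (intro powr_mono2) auto
  also have "\<dots> = M powr x * \<mu> powr x" using M1 \<mu>0 by (simp add: powr_mult)
  also have "\<dots> \<le> M * \<mu> powr x"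
    using powr_mono[OF x1 M1] M1 by (intro mult_right_mono) auto
  finally have P: "(real t / u ^ 2) powr x \<le> M * \<mu> powr x" .
  have B: "c ^ 3 * \<mu> powr x \<le> real b"
    unfolding \<mu>_def x_def d_def using degree_ratio_bound[OF a m0 mb b \<alpha>(1) _ \<beta>(2) c e'] \<beta> by simp
  have "c ^ 3 / (576 * M) * (real t * (real t / u ^ 2) powr x / u)
      \<le> c ^ 3 / (576 * M) * (real t * (real t / u ^ 2) powr x / 1)"
    using u1 c M1 by (intro mult_left_mono divide_left_mono) auto
  also have "\<dots> \<le> c ^ 3 / (576 * M) * (real t * (M * \<mu> powr x) / 1)"
    using P c M1 by (intro mult_left_mono divide_right_mono) auto
  also have "\<dots> = real t * (c ^ 3 * \<mu> powr x) / 576" using M1 by simp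
  also have "\<dots> \<le> real t * real b / 576" using B by (intro divide_right_mono mult_left_mono) auto
  also note r
  finally have "c ^ 3 / (576 * M) * (real t powr (1 + x) * u powr (- (2 * x + 1)))
      \<le> real (ramsey_number (cycle_graph (2 * l + 1)) t)"
    using powr_log_regroup[of "real t" u x] t2 u1 by simp
  moreover have "(\<alpha> * \<beta> - 3 * \<beta> + 2) / d = 1 + x" "(3 * \<alpha> * \<beta> - \<alpha> - 3 * \<beta> + 2) / d = 2 * x + 1"
    using ex \<beta> by auto
  ultimately show ?thesis
    using t2 ta a_ge unfolding M_def u_def by (intro exI[of _ t]) (simp add: mult.assoc)
qed

theorem theorem3:
  fixes l :: nat and \<alpha>\<^sub>0 \<beta> c\<^sub>0 :: real
    and G :: "nat \<Rightarrow> 'a graph"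
    and m n a b :: "nat \<Rightarrow> nat"
    and \<alpha> :: "nat \<Rightarrow> real"
  assumes "l \<ge> 1" and "\<alpha>\<^sub>0 \<ge> 1"
    and "0 < \<beta>" and "\<beta> \<le> (real l + 1) / (2 * real l + 1)"
    and "\<And>i. biregular (m i) (n i) (a i) (b i) (G i)"
    and "\<And>i. girth (G i) > enat (4 * l + 2)"
    and "\<And>i. a i \<ge> 2"
    and "filterlim n at_top sequentially"
    and "c\<^sub>0 > 0"
    and "\<And>i. real (card (edges (G i))) \<ge> c\<^sub>0 * (real (m i) * real (n i)) powr \<beta>"
    and "\<And>i. \<alpha> i = log (real (a i)) (real (b i))"
    and "\<And>i. 1 \<le> \<alpha> i \<and> \<alpha> i \<le> \<alpha>\<^sub>0"
  shows "\<exists>c :: real. c > 0 \<and> (\<exists>(I :: nat set) (t :: nat \<Rightarrow> nat).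
     infinite I \<and> (\<forall>i \<in> I. t i \<ge> 2) \<and>
     filterlim t at_top (inf sequentially (principal I)) \<and>
     (\<forall>i \<in> I. real (ramsey_number (cycle_graph (2 * l + 1)) (t i)) \<ge>
        c * real (t i) powr ((\<alpha> i * \<beta> - 3 * \<beta> + 2) / (\<alpha> i - 3 * \<beta> - \<alpha> i * \<beta> + 2))
          * log 2 (real (t i)) powr
              (- ((3 * \<alpha> i * \<beta> - \<alpha> i - 3 * \<beta> + 2) / (\<alpha> i - 3 * \<beta> - \<alpha> i * \<beta> + 2)))))"
proof -
  let ?r = "\<lambda>t. real (ramsey_number (cycle_graph (2 * l + 1)) t)"
  let ?e1 = "\<lambda>i. (\<alpha> i * \<beta> - 3 * \<beta> + 2) / (\<alpha> i - 3 * \<beta> - \<alpha> i * \<beta> + 2)"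
  let ?e2 = "\<lambda>i. (3 * \<alpha> i * \<beta> - \<alpha> i - 3 * \<beta> + 2) / (\<alpha> i - 3 * \<beta> - \<alpha> i * \<beta> + 2)"
  note l = assms(1) and G = assms(5) and girth = assms(6) and a2 = assms(7)
  have \<alpha>: "1 \<le> \<alpha> i" "\<alpha> i \<le> \<alpha>\<^sub>0" for i using assms(12) by auto
  have \<beta>23: "\<beta> \<le> 2 / 3"
  proof -
    have "(real l + 1) / (2 * real l + 1) \<le> 2 / 3" using l by (simp add: divide_le_eq)
    then show ?thesis using assms(4) by linarith
  qed
  show ?thesis
  proof (cases "\<beta> \<le> 1 / 2")
    case True
    \<comment> \<open>here the exponent \<open>x\<close> is not positive, and the trivial bound \<open>r(F, t) \<ge> t\<close> suffices for every \<open>t\<close>\<close>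
    define t where "t i = i + 2" for i :: nat
    have "1 / 16 * real (t i) powr ?e1 i * log 2 (real (t i)) powr (- ?e2 i) \<le> ?r (t i)" for i
    proof -
      define d where "d = \<alpha> i - 3 * \<beta> - \<alpha> i * \<beta> + 2"
      define x where "x = \<alpha> i * (2 * \<beta> - 1) / d"
      define u where "u = log 2 (real (t i))"
      note ex = exponent_arithmetic[OF \<alpha>(1)[of i] assms(3) \<beta>23, folded d_def, folded x_def]
      have x: "-1 \<le> x" "x \<le> 0"
        using ex(2,3) True \<alpha>(1)[of i] by (auto simp: x_def divide_le_0_iff mult_le_0_iff)
      have t2: "real (t i) \<ge> 2" by (simp add: t_def)
      have u1: "u \<ge> 1" using t2 by (simp add: u_def le_log_iff)
      have "ln (real (t i)) = 2 * ln (sqrt (real (t i)))" using t2 by (simp add: ln_sqrt)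
      also have "\<dots> \<le> 2 * sqrt (real (t i)) * 1"
        using ln_le_minus_one[of "sqrt (real (t i))"] t2 by simp
      also have "\<dots> \<le> 2 * sqrt (real (t i)) * (2 * ln 2)"
        using ln_le_minus_one[of "1/2 :: real"] by (intro mult_left_mono) (auto simp: ln_div)
      finally have "u \<le> 4 * sqrt (real (t i))"
        by (simp add: u_def log_def divide_le_eq)
      then have "u ^ 2 \<le> (4 * sqrt (real (t i))) ^ 2" using u1 by (intro power_mono) auto
      also have "\<dots> = 16 * real (t i)" by (simp add: power_mult_distrib)
      finally have "1 / 16 \<le> real (t i) / u ^ 2" using u1 by (simp add: divide_simps)
      then have "(real (t i) / u ^ 2) powr x \<le> (1 / 16) powr x"
        using x by (intro powr_mono2') auto
      also have "\<dots> \<le> (1 / 16) powr (-1)" using x by (intro powr_mono') auto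
      also have "\<dots> = (16::real)" by (simp add: powr_minus_divide)
      finally have P: "(real (t i) / u ^ 2) powr x \<le> 16" .
      have "real (t i) * (real (t i) / u ^ 2) powr x / u \<le> real (t i) * (real (t i) / u ^ 2) powr x / 1"
        using u1 by (intro divide_left_mono) auto
      also have "\<dots> \<le> real (t i) * 16" using P by (simp add: mult_left_mono)
      finally have "real (t i) * (real (t i) / u ^ 2) powr x / u \<le> real (t i) * 16" .
      then have "1 / 16 * (real (t i) * (real (t i) / u ^ 2) powr x / u) \<le> 1 / 16 * (real (t i) * 16)"
        by (rule mult_left_mono) simp
      also have "1 / 16 * (real (t i) * 16) = real (t i)" by simp
      also have "real (t i) * (real (t i) / u ^ 2) powr x / u = real (t i) powr (1 + x) * u powr (- (2 * x + 1))"
        using t2 u1 by (intro powr_log_regroup[symmetric]) auto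
      also have "real (t i) \<le> ?r (t i)"
      proof -
        have "edges (cycle_graph (2 * l + 1)) \<noteq> {}" by (auto simp: cycle_graph_def)
        then have "t i \<le> ramsey_number (cycle_graph (2 * l + 1)) (t i)"
          using l by (intro ramsey_number_ge_order simple_cycle_graph) (auto simp: t_def)
        then show ?thesis by simp
      qed
      finally show ?thesis using ex(5,6) by (simp add: d_def u_def mult.assoc)
    qed
    moreover have "filterlim t at_top (inf sequentially (principal UNIV))"
      unfolding t_def using filterlim_add_const_nat_at_top[of 2] by (simp del: add_2_eq_Suc')
    ultimately show ?thesis
      by (intro exI[of _ "1 / 16"] conjI exI[of _ UNIV] exI[of _ t]) (auto simp: t_def)
  next
    case False
    define s where "s = 2 * \<beta> - 1"
    define \<epsilon> where "\<epsilon> = s / (2 * \<alpha>\<^sub>0)"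
    define c where "c = min c\<^sub>0 1"
    define y where "y i = real (n i) + 1" for i
    have s: "s > 0" using False by (simp add: s_def)
    have \<epsilon>: "\<epsilon> > 0" using s assms(2) by (simp add: \<epsilon>_def)
    have c: "0 < c" "c \<le> 1" using assms(9) by (auto simp: c_def)
    have b: "real (b i) = real (a i) powr \<alpha> i" for i
    proof -
      have "a i \<le> b i" using G[of i] by (simp add: biregular_def)
      then show ?thesis using a2[of i] by (simp add: assms(11) powr_log_cancel)
    qed
    have e: "c * (real (m i) * real (n i)) powr \<beta> \<le> real (card (edges (G i)))" for i
    proof -
      have "c * (real (m i) * real (n i)) powr \<beta> \<le> c\<^sub>0 * (real (m i) * real (n i)) powr \<beta>"
        by (intro mult_right_mono) (auto simp: c_def)
      then show ?thesis using assms(10)[of i] by linarith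
    qed
    have y_top: "filterlim y at_top sequentially"
    proof (rule filterlim_at_top_mono)
      show "filterlim (\<lambda>i. real (n i)) at_top sequentially"
        using assms(8) by (simp add: filterlim_sequentially_iff_filterlim_real)
    qed (simp add: y_def)
    \<comment> \<open>the four conditions under which \<open>ramsey_number_odd_cycle_ge\<close> applies to \<open>G i\<close>\<close>
    have "eventually (\<lambda>y. y \<ge> 3 \<and> y powr (s / 2) \<ge> 2 powr s / c \<and> y powr (\<epsilon> / 2) \<ge> 80 / \<epsilon> ^ 2
        \<and> y powr \<epsilon> \<ge> 32) at_top"
      using s \<epsilon> by (intro eventually_conj eventually_ge_at_top eventually_powr_ge) auto
    then have "eventually (\<lambda>i. y i \<ge> 3 \<and> y i powr (s / 2) \<ge> 2 powr s / c \<and> y i powr (\<epsilon> / 2) \<ge> 80 / \<epsilon> ^ 2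
        \<and> y i powr \<epsilon> \<ge> 32) sequentially"
      by (rule eventually_compose_filterlim[OF _ y_top])
    then obtain i0 where i0: "\<And>i. i \<ge> i0 \<Longrightarrow> y i \<ge> 3 \<and> y i powr (s / 2) \<ge> 2 powr s / c
        \<and> y i powr (\<epsilon> / 2) \<ge> 80 / \<epsilon> ^ 2 \<and> y i powr \<epsilon> \<ge> 32"
      unfolding eventually_sequentially by blast
    define C where "C = c ^ 3 / (576 * max 1 (134 / \<epsilon> ^ 2))"
    have C: "C > 0" using c by (simp add: C_def)
    have "\<exists>t\<ge>2. y i powr \<epsilon> \<le> real t \<and>
        C * real t powr ?e1 i * log 2 (real t) powr (- ?e2 i) \<le> ?r t" if "i \<ge> i0" for i
      using i0[OF that] False unfolding y_def \<epsilon>_def s_def C_def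
      by (intro ramsey_number_odd_cycle_ge[OF l G girth a2 b \<alpha> _ \<beta>23 c e]) auto
    then obtain t where t: "\<And>i. i \<ge> i0 \<Longrightarrow> t i \<ge> 2 \<and> y i powr \<epsilon> \<le> real (t i) \<and>
        C * real (t i) powr ?e1 i * log 2 (real (t i)) powr (- ?e2 i) \<le> ?r (t i)"
      by metis
    have "filterlim (\<lambda>i. real (t i)) at_top sequentially"
      unfolding filterlim_at_top
    proof
      fix Z :: real
      have "eventually (\<lambda>i. y i powr \<epsilon> \<ge> Z) sequentially"
        by (rule eventually_compose_filterlim[OF eventually_powr_ge[OF \<epsilon>] y_top])
      then show "eventually (\<lambda>i. real (t i) \<ge> Z) sequentially"
        using eventually_ge_at_top[of i0] by eventually_elim (use t in force)
    qed
    then have "filterlim t at_top sequentially"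
      by (simp add: filterlim_sequentially_iff_filterlim_real)
    then have "filterlim t at_top (inf sequentially (principal {i0..}))"
      by (rule filterlim_mono[OF _ order_refl inf_le1])
    then show ?thesis
      using t C by (intro exI[of _ C] conjI exI[of _ "{i0..}"] exI[of _ t]) (auto simp: infinite_Ici)
  qed
qed

end
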